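(* Let $d \geq 2$ and $G = \mathbb{Z}^d$. Then there is the chain of inclusions of classes of $G$-subshifts $$\{\text{contractible SFTs}\} \subsetneq \{\text{FEP subshifts}\} \subsetneq \{\text{SFT factors of contractible SFTs}\} \subseteq \{\text{strongly irreducible SFTs}\},$$ where the first two inclusions are strict. Here an SFT factor of a contractible SFT is a $G$-SFT $Y$ for which there exist a contractible $G$-SFT $X$ and a surjective block map $X \to Y$.
   Context: For a finite set $A$ (alphabet) and a group $G$, $A^G$ carries the product topology (discrete $A$) and the shift action $(gx)_h = x_{g^{-1}h}$. A subshift is a topologically closed, shift-invariant subset $X \subset A^G$. A pattern is an element $p \in A^D$ with $D \subset G$. A pattern $q \in A^W$ with $W$ finite appears in a pattern $p \in A^E$ if for some $g \in G$ with $gW \subset E$ one has $p_{gw} = q_w$ for all $w \in W$. $X$ is a subshift of finite type (SFT) if there are a finite set $W \subset G$ (a window for $X$) and a set $\mathcal{F} \subset A^W$ of forbidden patterns such that $X$ is the set of $x \in A^G$ in which no pattern from $\mathcal{F}$ appears. Given the window $W$, one takes $\mathcal{F}$ to be the set of all patterns in $A^W$ that do not appear in any configuration of $X$. A pattern $p \in A^E$ is locally valid (with respect to $W$) if no element of $\mathcal{F}$ appears in it, and globally valid if $p = x|_E$ for some $x \in X$. An SFT $X \subset A^G$ has the finite extension property (is an FEP subshift) if for some window $W$ for $X$ there exists a finite set $N \subset G$ with $1_G \in N$ such that for every nonempty $D \subset G$ and every pattern $p \in A^D$: if $p$ is the restriction to $D$ of some locally valid pattern with domain $DN$ (the product set;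 $D+N$ in additive notation), then $p$ is globally valid. A block map between $G$-subshifts is a continuous shift-commuting map; products carry the diagonal action. Let $I = \{0,1\}^G$, with constant configurations $\bar 0, \bar 1$. A subshift $X$ is contractible if there is a block map $h : I \times X \times X \to X$ with $h(\bar 0, x, y) = x$ and $h(\bar 1, x, y) = y$ for all $x, y \in X$. $X \subset A^G$ is strongly irreducible if there exists $R$ such that for all $E, F \subset G$ with $\min_{a \in E, b \in F} d(a,b) \geq R$ (word metric for a finite symmetric generating set) and all $x, y \in X$ there exists $z \in X$ with $z|_E = x|_E$ and $z|_F = y|_F$. *)

theory Defs
  imports
    "HOL-Analysis.Analysis"
    "HOL-Library.Set_Algebras"
    "HOL-Library.Infinite_Typeclass"
begin

text \<open>
  Groups are written additively, as types of class \<open>group_add\<close> (addition is not assumed to be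
  commutative). A pattern with domain \<open>D\<close> over the alphabet \<open>A\<close> is an element of \<open>D \<rightarrow>\<^sub>E A\<close>; a
  configuration is a pattern with domain \<open>UNIV\<close>. A subshift is handled together with its alphabet,
  as a pair \<open>(A, X)\<close>.
\<close>

type_synonym ('g, 'a) shift_space = "'a set \<times> ('g \<Rightarrow> 'a) set"

abbreviation configs :: "'a set \<Rightarrow> ('g \<Rightarrow> 'a) set" where
  "configs A \<equiv> UNIV \<rightarrow>\<^sub>E A"

definition config_topology :: "'a set \<Rightarrow> ('g \<Rightarrow> 'a) topology" where
  "config_topology A = product_topology (\<lambda>_. discrete_topology A) UNIV"

definition shift :: "'g::group_add \<Rightarrow> ('g \<Rightarrow> 'a) \<Rightarrow> 'g \<Rightarrow> 'a" where
  "shift g x = (\<lambda>h. x (- g + h))"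

definition subshift :: "'a set \<Rightarrow> ('g::group_add \<Rightarrow> 'a) set \<Rightarrow> bool" where
  "subshift A X \<longleftrightarrow> finite A \<and> closedin (config_topology A) X \<and> (\<forall>g. shift g ` X \<subseteq> X)"


section \<open>Patterns, subshifts of finite type, finite extension property\<close>

definition appears_in ::
  "'g::group_add set \<Rightarrow> ('g \<Rightarrow> 'a) \<Rightarrow> 'g set \<Rightarrow> ('g \<Rightarrow> 'a) \<Rightarrow> bool" where
  "appears_in W q E p \<longleftrightarrow> (\<exists>g. (\<lambda>w. g + w) ` W \<subseteq> E \<and> (\<forall>w\<in>W. p (g + w) = q w))"

definition is_window :: "'a set \<Rightarrow> ('g::group_add \<Rightarrow> 'a) set \<Rightarrow> 'g set \<Rightarrow> bool" where
  "is_window A X W \<longleftrightarrow> finite W \<and>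
     (\<exists>F \<subseteq> W \<rightarrow>\<^sub>E A. X = {x \<in> configs A. \<forall>q\<in>F. \<not> appears_in W q UNIV x})"

definition sft :: "'a set \<Rightarrow> ('g::group_add \<Rightarrow> 'a) set \<Rightarrow> bool" where
  "sft A X \<longleftrightarrow> subshift A X \<and> (\<exists>W. is_window A X W)"

definition forbidden :: "'a set \<Rightarrow> ('g::group_add \<Rightarrow> 'a) set \<Rightarrow> 'g set \<Rightarrow> ('g \<Rightarrow> 'a) set" where
  "forbidden A X W = {q \<in> W \<rightarrow>\<^sub>E A. \<forall>x\<in>X. \<not> appears_in W q UNIV x}"

definition locally_valid ::
  "'a set \<Rightarrow> ('g::group_add \<Rightarrow> 'a) set \<Rightarrow> 'g set \<Rightarrow> 'g set \<Rightarrow> ('g \<Rightarrow> 'a) \<Rightarrow> bool" where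
  "locally_valid A X W E p \<longleftrightarrow>
     p \<in> E \<rightarrow>\<^sub>E A \<and> (\<forall>q\<in>forbidden A X W. \<not> appears_in W q E p)"

definition globally_valid :: "('g \<Rightarrow> 'a) set \<Rightarrow> 'g set \<Rightarrow> ('g \<Rightarrow> 'a) \<Rightarrow> bool" where
  "globally_valid X E p \<longleftrightarrow> (\<exists>x\<in>X. p = restrict x E)"

text \<open>\<open>D + N\<close> is the Minkowski sum.\<close>

definition fep :: "'a set \<Rightarrow> ('g::group_add \<Rightarrow> 'a) set \<Rightarrow> bool" where
  "fep A X \<longleftrightarrow> sft A X \<and>
     (\<exists>W. is_window A X W \<and>
       (\<exists>N. finite N \<and> 0 \<in> N \<and>
         (\<forall>D p. D \<noteq> {} \<and> p \<in> D \<rightarrow>\<^sub>E A \<and>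
            (\<exists>p'. locally_valid A X W (D + N) p' \<and> p = restrict p' D)
            \<longrightarrow> globally_valid X D p)))"


section \<open>Block maps and contractibility\<close>

definition equivariant_map ::
  "('g \<Rightarrow> 'x \<Rightarrow> 'x) \<Rightarrow> 'x topology \<Rightarrow> ('g \<Rightarrow> 'y \<Rightarrow> 'y) \<Rightarrow> 'y topology \<Rightarrow> ('x \<Rightarrow> 'y) \<Rightarrow> bool" where
  "equivariant_map act T act' T' f \<longleftrightarrow>
     continuous_map T T' f \<and> (\<forall>g. \<forall>x\<in>topspace T. f (act g x) = act' g (f x))"

definition shift_topology :: "'a set \<Rightarrow> ('g \<Rightarrow> 'a) set \<Rightarrow> ('g \<Rightarrow> 'a) topology" where
  "shift_topology A X = subtopology (config_topology A) X"

definition block_map ::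
  "'a set \<Rightarrow> ('g::group_add \<Rightarrow> 'a) set \<Rightarrow> 'b set \<Rightarrow> ('g \<Rightarrow> 'b) set
     \<Rightarrow> (('g \<Rightarrow> 'a) \<Rightarrow> ('g \<Rightarrow> 'b)) \<Rightarrow> bool" where
  "block_map A X B Y f \<longleftrightarrow>
     equivariant_map shift (shift_topology A X) shift (shift_topology B Y) f"

definition contractible_shift :: "'a set \<Rightarrow> ('g::group_add \<Rightarrow> 'a) set \<Rightarrow> bool" where
  "contractible_shift A X \<longleftrightarrow>
     (\<exists>h :: ('g \<Rightarrow> nat) \<times> ('g \<Rightarrow> 'a) \<times> ('g \<Rightarrow> 'a) \<Rightarrow> ('g \<Rightarrow> 'a).
        equivariant_map
          (\<lambda>g (i, x, y). (shift g i, shift g x, shift g y))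
          (prod_topology (config_topology {0, 1})
             (prod_topology (shift_topology A X) (shift_topology A X)))
          shift (shift_topology A X) h \<and>
        (\<forall>x\<in>X. \<forall>y\<in>X. h (\<lambda>_. 0, x, y) = x \<and> h (\<lambda>_. 1, x, y) = y))"


section \<open>Strong irreducibility\<close>

definition symmetric_generating_set :: "'g::group_add set \<Rightarrow> bool" where
  "symmetric_generating_set S \<longleftrightarrow>
     (\<forall>s\<in>S. - s \<in> S) \<and> (\<forall>g. \<exists>ws. set ws \<subseteq> S \<and> sum_list ws = g)"

definition word_metric :: "'g::group_add set \<Rightarrow> 'g \<Rightarrow> 'g \<Rightarrow> nat" where
  "word_metric S a b = (LEAST n. \<exists>ws. length ws = n \<and> set ws \<subseteq> S \<and> sum_list ws = - a + b)"

definition strongly_irreducible :: "'g::group_add set \<Rightarrow> ('g \<Rightarrow> 'a) set \<Rightarrow> bool" where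
  "strongly_irreducible S X \<longleftrightarrow>
     (\<exists>R. \<forall>E F. (\<forall>a\<in>E. \<forall>b\<in>F. word_metric S a b \<ge> R) \<longrightarrow>
        (\<forall>x\<in>X. \<forall>y\<in>X. \<exists>z\<in>X. restrict z E = restrict x E \<and> restrict z F = restrict y F))"


section \<open>Classes of subshifts\<close>

definition contractible_SFTs :: "('g::group_add, 'a) shift_space set" where
  "contractible_SFTs = {(A, X). sft A X \<and> contractible_shift A X}"

definition FEP_subshifts :: "('g::group_add, 'a) shift_space set" where
  "FEP_subshifts = {(A, X). fep A X}"

text \<open>
  The alphabet of the covering SFT lives in the same type as that of the factor. For an infinite
  type \<open>'a\<close> this is no restriction, as every finite alphabet can be renamed into \<open>'a\<close>.
\<close>

definition SFT_factors_of_contractible_SFTs :: "('g::group_add, 'a) shift_space set" where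
  "SFT_factors_of_contractible_SFTs =
     {(B, Y). sft B Y \<and>
        (\<exists>(A, X) \<in> (contractible_SFTs :: ('g, 'a) shift_space set).
            \<exists>f. block_map A X B Y f \<and> f ` X = Y)}"

definition strongly_irreducible_SFTs :: "'g::group_add set \<Rightarrow> ('g, 'a) shift_space set" where
  "strongly_irreducible_SFTs S = {(A, X). sft A X \<and> strongly_irreducible S X}"

end

theory Submission
  imports Defs
begin

text \<open>
  A contraction works like the homotopies of absolute retracts. If \<open>X\<close> is a contractible SFT and
  \<open>p\<close> is locally valid on a neighbourhood of \<open>D\<close>, then moving from \<open>p\<close> to an arbitrary configuration
  of \<open>X\<close> along the boundary of \<open>D\<close> extends \<open>p\<close> to a point of \<open>X\<close>; moving from one configuration to
  another in the same way gives strong irreducibility, which passes to factors.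

  An FEP subshift \<open>Y\<close> over \<open>A\<close> need not be contractible, but it is a factor of the product of the
  full shift over \<open>A\<close> with a contractible SFT \<open>C\<close> of coloured markers: the markers break the symmetry,
  so that an arbitrary configuration can be repaired to a point of \<open>Y\<close> ball by ball, one colour after
  the other, each round costing a margin of fixed width \<open>r\<close> by the finite extension property.
  The number of colours is bounded independently of the scale of the markers, so the balls
  can be taken large enough to survive all the erosions.

  For the first strict inclusion, take three symbols and forbid neighbouring horizontally constant rows
  with different symbols: the horizontally constant points are the fixed points, and
  there are several of them, which rules out a contraction. For the second, let \<open>Y\<close> be the \<open>\<int>/2\<close>-valued gradients
  of configurations in \<open>{0, 1}\<close>. It is the SFT of flat connections and a factor of a full shift,
  but a connection with nontrivial holonomy around a large hole is locally valid and does not extend.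
\<close>

text \<open>In the second inclusion both the cover and the map onto \<open>Y\<close> must commute
  with shifts, so no choice may depend on a position. Colours replace an ordering of the sites:
  those of one colour are treated simultaneously, and the colours have their turns in a fixed order.
  The device serves twice. Besides repairing configurations it contracts the marker shift: marks of
  one configuration are kept where \<open>i\<close> is 0, marks of the other where \<open>i\<close>
  is 1, a buffer between them is erased, and the gap is refilled with the starting configuration as
  guide. Filling does nothing where there is no gap, which gives the prescribed ends of the
  contraction; likewise repair fixes every point of \<open>Y\<close>, which gives surjectivity. The
  scale has to exceed the number of colours times \<open>r\<close>, so the colours must be counted
  before the scale is known. The count comes from greedy colouring: one colour more than the largest
  possible number of marks nearby, hence \<open>8 ^ CARD('n) + 1\<close>.\<close>

section \<open>Cylinders and local maps\<close>

text \<open>The cylinders described by finitely many coordinates \<open>e t g\<close> form a base of \<open>T\<close>; thus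
  continuity is dependence on finitely many coordinates.\<close>

definition cylindrical :: "'t topology \<Rightarrow> ('t \<Rightarrow> 'g \<Rightarrow> 'b) \<Rightarrow> bool" where
  "cylindrical T e \<longleftrightarrow> (\<forall>t\<in>topspace T.
     (\<forall>M. finite M \<longrightarrow> openin T {t' \<in> topspace T. \<forall>m\<in>M. e t' m = e t m}) \<and>
     (\<forall>U. openin T U \<and> t \<in> U \<longrightarrow>
        (\<exists>M. finite M \<and> {t' \<in> topspace T. \<forall>m\<in>M. e t' m = e t m} \<subseteq> U)))"

lemma cylindrical_openin:
  "cylindrical T e \<Longrightarrow> t \<in> topspace T \<Longrightarrow> finite M \<Longrightarrow>
     openin T {t' \<in> topspace T. \<forall>m\<in>M. e t' m = e t m}"
  by (auto simp: cylindrical_def)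

lemma cylindrical_basis:
  assumes "cylindrical T e" "openin T U" "t \<in> U"
  obtains M where "finite M" "{t' \<in> topspace T. \<forall>m\<in>M. e t' m = e t m} \<subseteq> U"
proof -
  have "t \<in> topspace T" using assms(2,3) openin_subset by blast
  then have "\<exists>M. finite M \<and> {t' \<in> topspace T. \<forall>m\<in>M. e t' m = e t m} \<subseteq> U"
    using assms unfolding cylindrical_def by simp
  then show ?thesis using that by blast
qed

lemma topspace_config_topology [simp]: "topspace (config_topology A) = configs A"
  by (simp add: config_topology_def)

lemma topspace_shift_topology: "X \<subseteq> configs A \<Longrightarrow> topspace (shift_topology A X) = X"
  by (auto simp: shift_topology_def)

lemma cylindrical_config_topology: "cylindrical (config_topology A) (\<lambda>x::'g \<Rightarrow> 'a. x)"
  unfolding cylindrical_def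
proof (intro ballI conjI allI impI)
  fix t :: "'g \<Rightarrow> 'a" and M :: "'g set"
  assume t: "t \<in> topspace (config_topology A)" and M: "finite M"
  have "{t' \<in> topspace (config_topology A). \<forall>m\<in>M. t' m = t m}
      = (\<Pi>\<^sub>E m\<in>UNIV. if m \<in> M then {t m} else A)"
    using t by (auto simp: PiE_iff split: if_splits)
  moreover have "finite {i. (if i \<in> M then {t i} else A) \<noteq> A}"
    by (rule finite_subset[OF _ M]) auto
  then have "openin (config_topology A) (\<Pi>\<^sub>E m\<in>UNIV. if m \<in> M then {t m} else A)"
    unfolding config_topology_def openin_PiE_gen using t by (auto simp: PiE_iff)
  ultimately show "openin (config_topology A)
      {t' \<in> topspace (config_topology A). \<forall>m\<in>M. t' m = t m}"
    by simp
next
  fix t :: "'g \<Rightarrow> 'a" and U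
  assume "openin (config_topology A) U \<and> t \<in> U"
  then obtain V where V: "finite {i \<in> UNIV. V i \<noteq> topspace (discrete_topology A)}"
      "t \<in> PiE UNIV V" "PiE UNIV V \<subseteq> U"
    unfolding config_topology_def openin_product_topology_alt
    by - (erule conjE, drule (1) bspec, elim exE conjE, rule that)
  define M where "M = {i. V i \<noteq> A}"
  have "{t' \<in> topspace (config_topology A). \<forall>m\<in>M. t' m = t m} \<subseteq> PiE UNIV V"
    using V(2) by (auto simp: PiE_iff M_def)
  moreover have "finite M" using V(1) by (simp add: M_def)
  ultimately show "\<exists>M. finite M \<and>
      {t' \<in> topspace (config_topology A). \<forall>m\<in>M. t' m = t m} \<subseteq> U"
    using V(3) by (intro exI[of _ M] conjI) (assumption, rule subset_trans)
qed

lemma cylindrical_subtopology: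
  assumes "cylindrical T e"
  shows "cylindrical (subtopology T X) e"
  unfolding cylindrical_def
proof (intro ballI conjI allI impI)
  fix t and M :: "'b set" assume t: "t \<in> topspace (subtopology T X)" and M: "finite M"
  have "{t' \<in> topspace (subtopology T X). \<forall>m\<in>M. e t' m = e t m}
      = {t' \<in> topspace T. \<forall>m\<in>M. e t' m = e t m} \<inter> X" by auto
  then show "openin (subtopology T X) {t' \<in> topspace (subtopology T X). \<forall>m\<in>M. e t' m = e t m}"
    using cylindrical_openin[OF assms, of t M] t M by (auto simp: openin_subtopology)
next
  fix t U assume t: "t \<in> topspace (subtopology T X)" and "openin (subtopology T X) U \<and> t \<in> U"
  then obtain V where V: "openin T V" "U = V \<inter> X" "t \<in> V" by (auto simp: openin_subtopology)
  obtain M where "finite M" "{t' \<in> topspace T. \<forall>m\<in>M. e t' m = e t m} \<subseteq> V"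
    using cylindrical_basis[OF assms V(1,3)] .
  then show "\<exists>M. finite M \<and> {t' \<in> topspace (subtopology T X). \<forall>m\<in>M. e t' m = e t m} \<subseteq> U"
    using V(2) by auto
qed

text \<open>Reading both factors at the same site makes a product of shift spaces behave like a
  space of configurations over pairs; the domain of a contraction is handled in this way.\<close>

lemma cylindrical_prod_topology:
  assumes T: "cylindrical T e" and T': "cylindrical T' e'"
  shows "cylindrical (prod_topology T T') (\<lambda>(t, t') g. (e t g, e' t' g))"
  unfolding cylindrical_def
proof (intro ballI conjI allI impI)
  fix p and M :: "'b set" assume p: "p \<in> topspace (prod_topology T T')" and M: "finite M"
  obtain t t' where [simp]: "p = (t, t')" by force
  have "{s \<in> topspace (prod_topology T T'). \<forall>m\<in>M. (case s of (t, t') \<Rightarrow> \<lambda>g. (e t g, e' t' g)) m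
         = (case p of (t, t') \<Rightarrow> \<lambda>g. (e t g, e' t' g)) m}
      = {s \<in> topspace T. \<forall>m\<in>M. e s m = e t m} \<times> {s \<in> topspace T'. \<forall>m\<in>M. e' s m = e' t' m}"
    by auto
  then show "openin (prod_topology T T')
      {s \<in> topspace (prod_topology T T'). \<forall>m\<in>M. (case s of (t, t') \<Rightarrow> \<lambda>g. (e t g, e' t' g)) m
         = (case p of (t, t') \<Rightarrow> \<lambda>g. (e t g, e' t' g)) m}"
    using cylindrical_openin[OF T, of t M] cylindrical_openin[OF T', of t' M] p M
    by (simp add: openin_prod_Times_iff)
next
  fix p U
  assume p: "p \<in> topspace (prod_topology T T')" and U: "openin (prod_topology T T') U \<and> p \<in> U"
  obtain t t' where [simp]: "p = (t, t')" by force
  obtain V V' where V: "openin T V" "openin T' V'" "t \<in> V" "t' \<in> V'" "V \<times> V' \<subseteq> U"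
    using U unfolding openin_prod_topology_alt by simp meson
  obtain M where M: "finite M" "{s \<in> topspace T. \<forall>m\<in>M. e s m = e t m} \<subseteq> V"
    using cylindrical_basis[OF T V(1,3)] .
  obtain M' where M': "finite M'" "{s \<in> topspace T'. \<forall>m\<in>M'. e' s m = e' t' m} \<subseteq> V'"
    using cylindrical_basis[OF T' V(2,4)] .
  show "\<exists>M. finite M \<and>
      {s \<in> topspace (prod_topology T T'). \<forall>m\<in>M. (case s of (t, t') \<Rightarrow> \<lambda>g. (e t g, e' t' g)) m
         = (case p of (t, t') \<Rightarrow> \<lambda>g. (e t g, e' t' g)) m} \<subseteq> U"
    using M M' V(5) by (intro exI[of _ "M \<union> M'"]) auto
qed

lemma continuous_map_cylindricalI:
  assumes T: "cylindrical T e" and T': "cylindrical T' e'"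
    and maps: "\<And>t. t \<in> topspace T \<Longrightarrow> f t \<in> topspace T'"
    and loc: "\<And>t g. t \<in> topspace T \<Longrightarrow> \<exists>M. finite M \<and>
      (\<forall>t'\<in>topspace T. (\<forall>m\<in>M. e t' m = e t m) \<longrightarrow> e' (f t') g = e' (f t) g)"
  shows "continuous_map T T' f"
  unfolding continuous_map_def
proof (intro conjI allI impI)
  show "f \<in> topspace T \<rightarrow> topspace T'" using maps by auto
  fix U assume U: "openin T' U"
  show "openin T {x \<in> topspace T. f x \<in> U}"
  proof (subst openin_subopen, intro ballI)
    fix t assume "t \<in> {x \<in> topspace T. f x \<in> U}"
    then have t: "t \<in> topspace T" "f t \<in> U" by auto
    obtain M' where M': "finite M'" "{s \<in> topspace T'. \<forall>m\<in>M'. e' s m = e' (f t) m} \<subseteq> U"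
      using cylindrical_basis[OF T' U t(2)] .
    obtain M where M: "\<And>g. finite (M g)"
        "\<And>g t'. t' \<in> topspace T \<Longrightarrow> \<forall>m\<in>M g. e t' m = e t m \<Longrightarrow> e' (f t') g = e' (f t) g"
      using loc[OF t(1)] by metis
    let ?M = "\<Union>g\<in>M'. M g"
    have "openin T {t' \<in> topspace T. \<forall>m\<in>?M. e t' m = e t m}"
      using cylindrical_openin[OF T t(1), of ?M] M(1) M'(1) by blast
    moreover have "{t' \<in> topspace T. \<forall>m\<in>?M. e t' m = e t m} \<subseteq> {x \<in> topspace T. f x \<in> U}"
    proof (intro subsetI CollectI conjI)
      fix t' assume t': "t' \<in> {t' \<in> topspace T. \<forall>m\<in>?M. e t' m = e t m}"
      then show "t' \<in> topspace T" by blast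
      have "\<forall>g\<in>M'. e' (f t') g = e' (f t) g" using t' by (blast intro: M(2))
      then show "f t' \<in> U" using M'(2) maps t' by blast
    qed
    ultimately show "\<exists>V. openin T V \<and> t \<in> V \<and> V \<subseteq> {x \<in> topspace T. f x \<in> U}"
      using t(1) by blast
  qed
qed

lemma continuous_map_cylindricalD:
  assumes T: "cylindrical T e" and T': "cylindrical T' e'"
    and f: "continuous_map T T' f" and t: "t \<in> topspace T"
  shows "\<exists>M. finite M \<and>
      (\<forall>t'\<in>topspace T. (\<forall>m\<in>M. e t' m = e t m) \<longrightarrow> e' (f t') g = e' (f t) g)"
proof -
  have ft: "f t \<in> topspace T'" using f t by (auto simp: continuous_map_def)
  let ?U = "{s \<in> topspace T'. \<forall>m\<in>{g}. e' s m = e' (f t) m}"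
  have "openin T' ?U" using cylindrical_openin[OF T' ft, of "{g}"] by blast
  then have "openin T {x \<in> topspace T. f x \<in> ?U}" using f unfolding continuous_map_def by blast
  moreover have "t \<in> {x \<in> topspace T. f x \<in> ?U}" using t ft by auto
  ultimately obtain M where "finite M"
      "{t' \<in> topspace T. \<forall>m\<in>M. e t' m = e t m} \<subseteq> {x \<in> topspace T. f x \<in> ?U}"
    using cylindrical_basis[OF T] by blast
  then show ?thesis by (intro exI[of _ M]) auto
qed

text \<open>The compactness half of the Curtis-Hedlund-Lyndon theorem: finitely many cylinders cover
  the space, and two points that agree on all their coordinates lie in a common one, so both are
  compared with the same centre.\<close>

lemma continuous_map_uniform:
  assumes T: "cylindrical T e" and T': "cylindrical T' e'" and comp: "compact_space T"
    and f: "continuous_map T T' f"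
  obtains M where "finite M"
    "\<And>t t'. t \<in> topspace T \<Longrightarrow> t' \<in> topspace T \<Longrightarrow> \<forall>m\<in>M. e t m = e t' m \<Longrightarrow>
       e' (f t) g = e' (f t') g"
proof -
  obtain N where N: "\<And>t. t \<in> topspace T \<Longrightarrow> finite (N t)"
      "\<And>t t'. t \<in> topspace T \<Longrightarrow> t' \<in> topspace T \<Longrightarrow> \<forall>m\<in>N t. e t' m = e t m \<Longrightarrow>
         e' (f t') g = e' (f t) g"
    using continuous_map_cylindricalD[OF T T' f, of _ g] by metis
  define V where "V = (\<lambda>t. {t' \<in> topspace T. \<forall>m\<in>N t. e t' m = e t m})"
  have "\<forall>U\<in>V ` topspace T. openin T U"
    unfolding V_def using cylindrical_openin[OF T _ N(1)] by blast
  moreover have "topspace T \<subseteq> \<Union> (V ` topspace T)" unfolding V_def by blast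
  ultimately obtain \<F> where \<F>: "finite \<F>" "\<F> \<subseteq> V ` topspace T" "topspace T \<subseteq> \<Union>\<F>"
    using comp unfolding compact_space_alt by meson
  obtain B where B: "B \<subseteq> topspace T" "finite B" "\<F> = V ` B"
    using finite_subset_image[OF \<F>(1,2)] by blast
  show ?thesis
  proof
    show "finite (\<Union>t\<in>B. N t)" using B N(1) by blast
    fix t t' assume t: "t \<in> topspace T" "t' \<in> topspace T" and eq: "\<forall>m\<in>\<Union>t\<in>B. N t. e t m = e t' m"
    obtain b where b: "b \<in> B" "t \<in> V b" using \<F>(3) B(3) t(1) by blast
    have "t' \<in> V b" using b eq t by (auto simp: V_def)
    have "e' (f t) g = e' (f b) g" "e' (f t') g = e' (f b) g"
      using b \<open>t' \<in> V b\<close> B(1) t by (auto simp: V_def intro!: N(2))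
    then show "e' (f t) g = e' (f t') g" by simp
  qed
qed

section \<open>Compactness of subshifts and memory of block maps\<close>

lemma compact_space_config_topology: "finite A \<Longrightarrow> compact_space (config_topology A)"
  by (simp add: config_topology_def compact_space_product_topology compact_space_discrete_topology)

lemma subshift_subset_configs: "subshift A X \<Longrightarrow> X \<subseteq> configs A"
  unfolding subshift_def by (metis closedin_subset topspace_config_topology)

lemma subshift_shift: "subshift A X \<Longrightarrow> x \<in> X \<Longrightarrow> shift g x \<in> X"
  by (auto simp: subshift_def)

lemma compact_space_shift_topology: "subshift A X \<Longrightarrow> compact_space (shift_topology A X)"
  unfolding shift_topology_def subshift_def
  by (simp add: closedin_compact_space compact_space_config_topology compact_space_subtopology)

lemma cylindrical_shift_topology: "cylindrical (shift_topology A X) (\<lambda>x. x)"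
  unfolding shift_topology_def by (intro cylindrical_subtopology cylindrical_config_topology)

lemma shift_apply: "shift g x h = x (- g + h)"
  by (simp add: shift_def)

lemma shift_minus_apply: "shift (- g) x h = x (g + h)"
  by (simp add: shift_def)

lemma shift_in_configs: "x \<in> configs A \<Longrightarrow> shift g x \<in> configs A"
  by (auto simp: shift_def PiE_iff)

text \<open>A memory set for the value at 0 serves at every site, because shifting by
  \<open>- g\<close> moves the site \<open>g\<close> to the origin.\<close>

lemma block_map_memory:
  assumes X: "subshift A X" and f: "block_map A X B Y f"
  obtains M where "finite M"
    "\<And>x x' g. x \<in> X \<Longrightarrow> x' \<in> X \<Longrightarrow> \<forall>m\<in>M. x (g + m) = x' (g + m) \<Longrightarrow> f x g = f x' g"
proof -
  note XA = subshift_subset_configs[OF X]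
  have cont: "continuous_map (shift_topology A X) (shift_topology B Y) f"
    and eqv: "\<And>g x. x \<in> X \<Longrightarrow> f (shift g x) = shift g (f x)"
    using f topspace_shift_topology[OF XA] by (auto simp: block_map_def equivariant_map_def)
  obtain M where M: "finite M"
      "\<And>x x'. x \<in> X \<Longrightarrow> x' \<in> X \<Longrightarrow> \<forall>m\<in>M. x m = x' m \<Longrightarrow> f x 0 = f x' 0"
    using continuous_map_uniform[OF cylindrical_shift_topology cylindrical_shift_topology
        compact_space_shift_topology[OF X] cont, of 0] topspace_shift_topology[OF XA] by metis
  show ?thesis
  proof
    show "finite M" by fact
    fix x x' g assume x: "x \<in> X" "x' \<in> X" and eq: "\<forall>m\<in>M. x (g + m) = x' (g + m)"
    have "f (shift (- g) x) 0 = f (shift (- g) x') 0"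
      using eq x by (intro M(2)) (auto simp: shift_minus_apply subshift_shift[OF X])
    then show "f x g = f x' g" using x by (simp add: eqv shift_minus_apply)
  qed
qed

text \<open>Locality and equivariance of a map between full shifts, in one condition.\<close>

definition local_map :: "(('g::group_add \<Rightarrow> 'b) \<Rightarrow> 'g \<Rightarrow> 'c) \<Rightarrow> bool" where
  "local_map f \<longleftrightarrow> (\<exists>M. finite M \<and> (\<forall>x x' g g'.
     (\<forall>m\<in>M. x (g + m) = x' (g' + m)) \<longrightarrow> f x g = f x' g'))"

lemma local_mapI:
  assumes "finite M" "\<And>x x' g g'. (\<And>m. m \<in> M \<Longrightarrow> x (g + m) = x' (g' + m)) \<Longrightarrow> f x g = f x' g'"
  shows "local_map f"
  unfolding local_map_def using assms by metis

lemma local_mapE: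
  assumes "local_map f"
  obtains M where "finite M" "\<And>x x' g g'. \<forall>m\<in>M. x (g + m) = x' (g' + m) \<Longrightarrow> f x g = f x' g'"
proof -
  from assms obtain M where "finite M"
      and M: "\<forall>x x' g g'. (\<forall>m\<in>M. x (g + m) = x' (g' + m)) \<longrightarrow> f x g = f x' g'"
    unfolding local_map_def by (elim exE conjE)
  from \<open>finite M\<close> show ?thesis
    by (rule that[OF _ M[THEN spec, THEN spec, THEN spec, THEN spec, THEN mp]])
qed

lemma local_map_compose:
  fixes f :: "('g::group_add \<Rightarrow> 'c) \<Rightarrow> 'g \<Rightarrow> 'd" and f' :: "('g \<Rightarrow> 'b) \<Rightarrow> 'g \<Rightarrow> 'c"
  assumes "local_map f" "local_map f'"
  shows "local_map (\<lambda>x. f (f' x))"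
proof -
  obtain M where M: "finite M" "\<And>x x' g g'. \<forall>m\<in>M. x (g + m) = x' (g' + m) \<Longrightarrow> f x g = f x' g'"
    by (rule local_mapE[OF assms(1)]) (rule that)
  obtain M' where M': "finite M'"
      "\<And>x x' g g'. \<forall>m\<in>M'. x (g + m) = x' (g' + m) \<Longrightarrow> f' x g = f' x' g'"
    by (rule local_mapE[OF assms(2)]) (rule that)
  show ?thesis
  proof (rule local_mapI)
    show "finite (M + M')" using M(1) M'(1) by (rule finite_set_plus)
    fix x x' :: "'g \<Rightarrow> 'b" and g g' assume eq: "\<And>m. m \<in> M + M' \<Longrightarrow> x (g + m) = x' (g' + m)"
    show "f (f' x) g = f (f' x') g'"
    proof (intro M(2) M'(2) ballI)
      fix m m' assume "m \<in> M" "m' \<in> M'"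
      then show "x (g + m + m') = x' (g' + m + m')"
        using eq[of "m + m'"] by (simp add: set_plus_intro add.assoc)
    qed
  qed
qed

lemma local_map_pair:
  fixes f :: "('g::group_add \<Rightarrow> 'b) \<Rightarrow> 'g \<Rightarrow> 'c" and f' :: "('g \<Rightarrow> 'b) \<Rightarrow> 'g \<Rightarrow> 'd"
  assumes "local_map f" "local_map f'"
  shows "local_map (\<lambda>x g. (f x g, f' x g))"
proof -
  obtain M where M: "finite M" "\<And>x x' g g'. \<forall>m\<in>M. x (g + m) = x' (g' + m) \<Longrightarrow> f x g = f x' g'"
    by (rule local_mapE[OF assms(1)]) (rule that)
  obtain M' where M': "finite M'"
      "\<And>x x' g g'. \<forall>m\<in>M'. x (g + m) = x' (g' + m) \<Longrightarrow> f' x g = f' x' g'"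
    by (rule local_mapE[OF assms(2)]) (rule that)
  show ?thesis
  proof (rule local_mapI)
    show "finite (M \<union> M')" using M(1) M'(1) by blast
    fix x x' :: "'g \<Rightarrow> 'b" and g g' assume eq: "\<And>m. m \<in> M \<union> M' \<Longrightarrow> x (g + m) = x' (g' + m)"
    show "(f x g, f' x g) = (f x' g', f' x' g')"
      using M(2)[of x g x' g'] M'(2)[of x g x' g'] eq by auto
  qed
qed

lemma local_map_pointwise: "local_map (\<lambda>x g. \<phi> (x g))"
proof (rule local_mapI)
  show "finite {0 :: 'a}" by simp
  fix x x' :: "'a \<Rightarrow> 'b" and g g'
  assume "\<And>m. m \<in> {0} \<Longrightarrow> x (g + m) = x' (g' + m)"
  from this[of 0] show "\<phi> (x g) = \<phi> (x' g')" by simp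
qed

lemma local_map_equivariant:
  assumes "local_map f"
  shows "f (shift g x) = shift g (f x)"
proof
  fix h
  obtain M where "\<And>x x' g g'. \<forall>m\<in>M. x (g + m) = x' (g' + m) \<Longrightarrow> f x g = f x' g'"
    by (rule local_mapE[OF assms]) (rule that)
  from this[of "shift g x" h x "- g + h"] show "f (shift g x) h = shift g (f x) h"
    by (simp add: shift_apply add.assoc)
qed

lemma block_map_local_map:
  assumes f: "local_map f" and X: "X \<subseteq> configs A" and Y: "Y \<subseteq> configs B"
    and maps: "\<And>x. x \<in> X \<Longrightarrow> f x \<in> Y"
  shows "block_map A X B Y f"
  unfolding block_map_def equivariant_map_def
proof (intro conjI allI ballI)
  obtain M where M: "finite M" "\<And>x x' g g'. \<forall>m\<in>M. x (g + m) = x' (g' + m) \<Longrightarrow> f x g = f x' g'"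
    by (rule local_mapE[OF f]) (rule that)
  show "continuous_map (shift_topology A X) (shift_topology B Y) f"
  proof (rule continuous_map_cylindricalI[OF cylindrical_shift_topology cylindrical_shift_topology])
    show "f t \<in> topspace (shift_topology B Y)" if "t \<in> topspace (shift_topology A X)" for t
      using that maps by (simp add: topspace_shift_topology X Y)
    show "\<exists>M. finite M \<and> (\<forall>t'\<in>topspace (shift_topology A X). (\<forall>m\<in>M. t' m = t m) \<longrightarrow> f t' g = f t g)"
      for t g
    proof (intro exI[of _ "(+) g ` M"] conjI ballI impI)
      fix t' assume "\<forall>m\<in>(+) g ` M. t' m = t m"
      then show "f t' g = f t g" by (intro M(2)) auto
    qed (use M(1) in simp)
  qed
qed (rule local_map_equivariant[OF f])

text \<open>The form in which a contraction is used: curried, with one memory set around every site.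
  Where \<open>i\<close> is constantly 0 or 1 near \<open>g\<close>, the last clause lets the value
  at \<open>g\<close> be read off from the end conditions.\<close>

lemma contractible_shift_memory:
  fixes X :: "('g::group_add \<Rightarrow> 'a) set"
  assumes X: "subshift A X" and con: "contractible_shift A X"
  obtains h M where
    "finite M"
    "\<And>i x y. i \<in> configs {0, 1 :: nat} \<Longrightarrow> x \<in> X \<Longrightarrow> y \<in> X \<Longrightarrow> h i x y \<in> X"
    "\<And>i x y g. i \<in> configs {0, 1 :: nat} \<Longrightarrow> x \<in> X \<Longrightarrow> y \<in> X \<Longrightarrow>
       h (shift g i) (shift g x) (shift g y) = shift g (h i x y)"
    "\<And>x y. x \<in> X \<Longrightarrow> y \<in> X \<Longrightarrow> h (\<lambda>_. 0) x y = x"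
    "\<And>x y. x \<in> X \<Longrightarrow> y \<in> X \<Longrightarrow> h (\<lambda>_. 1) x y = y"
    "\<And>i x y i' x' y' g. i \<in> configs {0, 1 :: nat} \<Longrightarrow> x \<in> X \<Longrightarrow> y \<in> X \<Longrightarrow>
       i' \<in> configs {0, 1 :: nat} \<Longrightarrow> x' \<in> X \<Longrightarrow> y' \<in> X \<Longrightarrow>
       \<forall>m\<in>M. i (g + m) = i' (g + m) \<and> x (g + m) = x' (g + m) \<and> y (g + m) = y' (g + m) \<Longrightarrow>
       h i x y g = h i' x' y' g"
proof -
  note XA = subshift_subset_configs[OF X]
  note topX = topspace_shift_topology[OF XA]
  let ?I = "config_topology {0, 1} :: ('g \<Rightarrow> nat) topology" and ?X = "shift_topology A X"
  let ?T = "prod_topology ?I (prod_topology ?X ?X)"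
  let ?e = "\<lambda>(i::'g \<Rightarrow> nat, p) g. (i g, (case p of (x::'g \<Rightarrow> 'a, y::'g \<Rightarrow> 'a) \<Rightarrow> \<lambda>g. (x g, y g)) g)"
  obtain h where h: "equivariant_map (\<lambda>g (i, x, y). (shift g i, shift g x, shift g y)) ?T shift ?X h"
      "\<And>x y. x \<in> X \<Longrightarrow> y \<in> X \<Longrightarrow> h (\<lambda>_. 0, x, y) = x \<and> h (\<lambda>_. 1, x, y) = y"
    using con unfolding contractible_shift_def by (elim exE conjE) simp
  have cont: "continuous_map ?T ?X h"
    and eqv: "\<And>i x y g. i \<in> configs {0, 1} \<Longrightarrow> x \<in> X \<Longrightarrow> y \<in> X \<Longrightarrow>
       h (shift g i, shift g x, shift g y) = shift g (h (i, x, y))"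
    using h(1) by (auto simp: equivariant_map_def topX)
  have cyl: "cylindrical ?T ?e"
    by (intro cylindrical_prod_topology cylindrical_config_topology cylindrical_shift_topology)
  have comp: "compact_space ?T"
    by (simp add: compact_space_prod_topology compact_space_config_topology
        compact_space_shift_topology[OF X])
  obtain M where M: "finite M" "\<And>t t'. t \<in> topspace ?T \<Longrightarrow> t' \<in> topspace ?T \<Longrightarrow>
      \<forall>m\<in>M. ?e t m = ?e t' m \<Longrightarrow> h t 0 = h t' 0"
    by (rule continuous_map_uniform[OF cyl cylindrical_shift_topology comp cont, of 0]) (rule that)
  show ?thesis
  proof (rule that[of M "\<lambda>i x y. h (i, x, y)"])
    show "h (i, x, y) \<in> X" if "i \<in> configs {0, 1}" "x \<in> X" "y \<in> X" for i x y
      using cont that by (auto simp: continuous_map_def topX)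
    fix i i' :: "'g \<Rightarrow> nat" and x y x' y' g
    assume *: "i \<in> configs {0, 1}" "x \<in> X" "y \<in> X" "i' \<in> configs {0, 1}" "x' \<in> X" "y' \<in> X"
      "\<forall>m\<in>M. i (g + m) = i' (g + m) \<and> x (g + m) = x' (g + m) \<and> y (g + m) = y' (g + m)"
    have "h (shift (- g) i, shift (- g) x, shift (- g) y) 0
        = h (shift (- g) i', shift (- g) x', shift (- g) y') 0"
      using * by (intro M(2)) (auto simp: topX subshift_shift[OF X] shift_in_configs shift_minus_apply
          simp del: PiE_UNIV_domain insert_iff)
    then show "h (i, x, y) g = h (i', x', y') g"
      using * by (simp add: eqv shift_minus_apply del: PiE_UNIV_domain insert_iff)
  qed (use h(2) eqv M(1) in auto)
qed

text \<open>Packing \<open>i\<close>, \<open>x\<close> and \<open>y\<close> into a single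
  configuration makes the closure properties of \<open>local_map\<close> available for building
  contractions.\<close>

lemma contractible_shift_local_map:
  fixes H :: "('g::group_add \<Rightarrow> nat \<times> 'a \<times> 'a) \<Rightarrow> 'g \<Rightarrow> 'a"
  assumes XA: "X \<subseteq> configs A" and H: "local_map H"
    and maps: "\<And>i x y. i \<in> configs {0, 1} \<Longrightarrow> x \<in> X \<Longrightarrow> y \<in> X \<Longrightarrow> H (\<lambda>g. (i g, x g, y g)) \<in> X"
    and ends: "\<And>x y. x \<in> X \<Longrightarrow> y \<in> X \<Longrightarrow> H (\<lambda>g. (0, x g, y g)) = x"
      "\<And>x y. x \<in> X \<Longrightarrow> y \<in> X \<Longrightarrow> H (\<lambda>g. (1, x g, y g)) = y"
  shows "contractible_shift A X"
  unfolding contractible_shift_def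
proof (intro exI conjI)
  let ?h = "\<lambda>(i, x, y). H (\<lambda>g. (i g, x g, y g))"
  show "\<forall>x\<in>X. \<forall>y\<in>X. ?h (\<lambda>_. 0, x, y) = x \<and> ?h (\<lambda>_. 1, x, y) = y" using ends by auto
  note topX = topspace_shift_topology[OF XA]
  let ?I = "config_topology {0, 1} :: ('g \<Rightarrow> nat) topology" and ?X = "shift_topology A X"
  let ?T = "prod_topology ?I (prod_topology ?X ?X)"
  let ?e = "\<lambda>(i::'g \<Rightarrow> nat, p) g. (i g, (case p of (x::'g \<Rightarrow> 'a, y::'g \<Rightarrow> 'a) \<Rightarrow> \<lambda>g. (x g, y g)) g)"
  obtain M where M: "finite M" "\<And>x x' g g'. \<forall>m\<in>M. x (g + m) = x' (g' + m) \<Longrightarrow> H x g = H x' g'"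
    by (rule local_mapE[OF H]) (rule that)
  have cyl: "cylindrical ?T ?e"
    by (intro cylindrical_prod_topology cylindrical_config_topology cylindrical_shift_topology)
  show "equivariant_map (\<lambda>g (i, x, y). (shift g i, shift g x, shift g y)) ?T shift ?X ?h"
    unfolding equivariant_map_def
  proof (intro conjI allI ballI)
    show "continuous_map ?T ?X ?h"
    proof (rule continuous_map_cylindricalI[OF cyl cylindrical_shift_topology])
      show "?h t \<in> topspace ?X" if "t \<in> topspace ?T" for t
        using that maps by (auto simp: topX)
      show "\<exists>M. finite M \<and>
          (\<forall>t'\<in>topspace ?T. (\<forall>m\<in>M. ?e t' m = ?e t m) \<longrightarrow> ?h t' g = ?h t g)" for t g
      proof (intro exI[of _ "(+) g ` M"] conjI ballI impI)
        fix t' assume "\<forall>m\<in>(+) g ` M. ?e t' m = ?e t m"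
        then show "?h t' g = ?h t g" by (cases t; cases t') (auto intro!: M(2))
      qed (use M(1) in simp)
    qed
    fix g t
    show "?h ((\<lambda>(i, x, y). (shift g i, shift g x, shift g y)) t) = shift g (?h t)"
      using local_map_equivariant[OF H, of g "\<lambda>h. (fst t h, fst (snd t) h, snd (snd t) h)"]
      by (auto simp: shift_def split: prod.splits)
  qed
qed

text \<open>The forbidden patterns are those on \<open>W\<close> that violate \<open>P\<close>; by
  \<open>loc\<close> the values off \<open>W\<close> do not influence \<open>P\<close>. The set is
  closed since a violation at \<open>g\<close> persists on a whole cylinder.\<close>

lemma sft_localI:
  fixes P :: "('g::group_add \<Rightarrow> 'a) \<Rightarrow> bool"
  assumes A: "finite A" and W: "finite W"
    and loc: "\<And>x y. \<forall>w\<in>W. x w = y w \<Longrightarrow> P x \<Longrightarrow> P y"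
    and X: "X = {x \<in> configs A. \<forall>g. P (\<lambda>h. x (g + h))}"
  shows "is_window A X W" "sft A X"
proof -
  have *: "P x \<longleftrightarrow> P y" if "\<forall>w\<in>W. x w = y w" for x y using loc[of x y] loc[of y x] that by auto
  show win: "is_window A X W"
    unfolding is_window_def
  proof (intro conjI exI)
    show "finite W" by fact
    show "{q \<in> W \<rightarrow>\<^sub>E A. \<not> P q} \<subseteq> W \<rightarrow>\<^sub>E A" by blast
    show "X = {x \<in> configs A. \<forall>q\<in>{q \<in> W \<rightarrow>\<^sub>E A. \<not> P q}. \<not> appears_in W q UNIV x}"
    proof (intro equalityI subsetI)
      fix x assume x: "x \<in> X"
      have "\<not> appears_in W q UNIV x" if "\<not> P q" for q
      proof
        assume "appears_in W q UNIV x"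
        then obtain g where "\<forall>w\<in>W. x (g + w) = q w" by (auto simp: appears_in_def)
        then show False using *[of "\<lambda>h. x (g + h)" q] x that by (auto simp: X)
      qed
      then show "x \<in> {x \<in> configs A. \<forall>q\<in>{q \<in> W \<rightarrow>\<^sub>E A. \<not> P q}. \<not> appears_in W q UNIV x}"
        using x by (auto simp: X)
    next
      fix x assume x: "x \<in> {x \<in> configs A. \<forall>q\<in>{q \<in> W \<rightarrow>\<^sub>E A. \<not> P q}. \<not> appears_in W q UNIV x}"
      have "P (\<lambda>h. x (g + h))" for g
      proof (rule ccontr)
        assume "\<not> P (\<lambda>h. x (g + h))"
        then have "\<not> P (restrict (\<lambda>h. x (g + h)) W)"
          using *[of "\<lambda>h. x (g + h)" "restrict (\<lambda>h. x (g + h)) W"] by simp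
        moreover have "restrict (\<lambda>h. x (g + h)) W \<in> W \<rightarrow>\<^sub>E A" using x by auto
        moreover have "appears_in W (restrict (\<lambda>h. x (g + h)) W) UNIV x"
          by (auto simp: appears_in_def)
        ultimately show False using x by blast
      qed
      then show "x \<in> X" using x by (auto simp: X)
    qed
  qed
  have "closedin (config_topology A) X"
    unfolding closedin_def
  proof
    show "X \<subseteq> topspace (config_topology A)" by (auto simp: X)
    show "openin (config_topology A) (topspace (config_topology A) - X)"
    proof (subst openin_subopen, intro ballI)
      fix x assume "x \<in> topspace (config_topology A) - X"
      then obtain g where x: "x \<in> configs A" and g: "\<not> P (\<lambda>h. x (g + h))" by (auto simp: X)
      let ?U = "{y \<in> topspace (config_topology A). \<forall>m\<in>(+) g ` W. y m = x m}"
      have "openin (config_topology A) ?U"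
        using cylindrical_openin[OF cylindrical_config_topology, of x A "(+) g ` W"] x W by simp
      moreover have "y \<notin> X" if "y \<in> ?U" for y
        using that g *[of "\<lambda>h. x (g + h)" "\<lambda>h. y (g + h)"] by (auto simp: X)
      ultimately show "\<exists>U. openin (config_topology A) U \<and> x \<in> U \<and>
          U \<subseteq> topspace (config_topology A) - X"
        using x by (intro exI[of _ ?U]) auto
    qed
  qed
  moreover have "shift g x \<in> X" if "x \<in> X" for g x
  proof -
    have "(\<lambda>h. shift g x (g' + h)) = (\<lambda>h. x ((- g + g') + h))" for g'
      by (simp add: shift_def add.assoc)
    then show ?thesis using that shift_in_configs[of x A g] by (simp add: X)
  qed
  ultimately show "sft A X" using A win by (auto simp: sft_def subshift_def)
qed

section \<open>Gluing along a contraction\<close>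

lemma not_forbidden: "x \<in> X \<Longrightarrow> restrict (\<lambda>w. x (g + w)) W \<notin> forbidden A X W"
  by (auto simp: forbidden_def appears_in_def)

text \<open>Whatever \<open>F\<close> witnesses the window, its members occur in no point of
  \<open>X\<close> and so belong to \<open>forbidden A X W\<close>; the maximal set of forbidden
  patterns therefore defines the same \<open>X\<close>.\<close>

lemma window_config:
  assumes win: "is_window A X W" and x: "x \<in> configs A"
    and ok: "\<And>g. restrict (\<lambda>w. x (g + w)) W \<notin> forbidden A X W"
  shows "x \<in> X"
proof -
  obtain F where F: "F \<subseteq> W \<rightarrow>\<^sub>E A" "X = {x \<in> configs A. \<forall>q\<in>F. \<not> appears_in W q UNIV x}"
    using win unfolding is_window_def by blast
  have "\<not> appears_in W q UNIV x" if q: "q \<in> F" for q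
  proof
    assume "appears_in W q UNIV x"
    then obtain g where g: "\<forall>w\<in>W. x (g + w) = q w" by (auto simp: appears_in_def)
    have qW: "q \<in> W \<rightarrow>\<^sub>E A" using F(1) q by blast
    have "restrict (\<lambda>w. x (g + w)) W = q"
      using g qW by (auto simp: PiE_iff extensional_def)
    moreover have "q \<in> forbidden A X W"
      using qW q by (auto simp: forbidden_def F(2))
    ultimately show False using ok[of g] by simp
  qed
  then show ?thesis using x F(2) by blast
qed

lemma locally_valid_iff:
  "locally_valid A X W E p \<longleftrightarrow> p \<in> E \<rightarrow>\<^sub>E A \<and>
     (\<forall>g. (+) g ` W \<subseteq> E \<longrightarrow> restrict (\<lambda>w. p (g + w)) W \<notin> forbidden A X W)"
proof -
  have "(\<forall>q\<in>forbidden A X W. \<not> appears_in W q E p) \<longleftrightarrow>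
      (\<forall>g. (+) g ` W \<subseteq> E \<longrightarrow> restrict (\<lambda>w. p (g + w)) W \<notin> forbidden A X W)" (is "?L \<longleftrightarrow> ?R")
  proof
    assume ?L
    have "appears_in W (restrict (\<lambda>w. p (g + w)) W) E p" if "(+) g ` W \<subseteq> E" for g
      using that by (auto simp: appears_in_def)
    then show ?R using \<open>?L\<close> by blast
  next
    assume R: ?R
    show ?L
    proof (intro ballI notI)
      fix q assume q: "q \<in> forbidden A X W" and "appears_in W q E p"
      then obtain g where g: "(+) g ` W \<subseteq> E" "\<forall>w\<in>W. p (g + w) = q w"
        by (auto simp: appears_in_def)
      then have "restrict (\<lambda>w. p (g + w)) W = q"
        using q by (auto simp: forbidden_def PiE_iff extensional_def)
      then show False using R g(1) q by metis
    qed
  qed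
  then show ?thesis by (simp add: locally_valid_def)
qed

text \<open>Every configuration outside \<open>X\<close> shows a bad window at some place, and by
  compactness finitely many places suffice. A pattern that is locally valid around \<open>g\<close>
  shows none of these windows, so on \<open>L\<close> it looks like a point of
  \<open>X\<close>.\<close>

lemma locally_valid_compactness:
  assumes X: "subshift A X" and win: "is_window A X W" and L: "finite L"
  obtains L' where "finite L'" "L \<subseteq> L'" "0 \<in> L'"
    "\<And>g E p. locally_valid A X W E p \<Longrightarrow> (+) g ` L' \<subseteq> E \<Longrightarrow>
       \<exists>x\<in>X. \<forall>l\<in>L. x (g + l) = p (g + l)"
proof -
  note XA = subshift_subset_configs[OF X]
  have finA: "finite A" and finW: "finite W" using X win by (auto simp: subshift_def is_window_def)
  let ?bad = "\<lambda>x g. restrict (\<lambda>w. x (g + w)) W \<in> forbidden A X W"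
  obtain G where G: "\<And>x. x \<in> configs A \<Longrightarrow> x \<notin> X \<Longrightarrow> ?bad x (G x)"
    using window_config[OF win] by metis
  \<comment> \<open>The coordinates to compare: a violated window for a configuration outside
    \<open>X\<close>, and \<open>L\<close> for a point of \<open>X\<close>.\<close>
  define K where "K = (\<lambda>x. if x \<in> X then L else (+) (G x) ` W)"
  define U where "U = (\<lambda>x. {y \<in> topspace (config_topology A). \<forall>m\<in>K x. y m = x m})"
  have finK: "finite (K x)" for x using L finW by (simp add: K_def)
  have "openin (config_topology A) (U x)" if "x \<in> configs A" for x
    unfolding U_def by (rule cylindrical_openin[OF cylindrical_config_topology _ finK]) (simp add: that)
  then have "\<forall>V\<in>U ` configs A. openin (config_topology A) V" by blast
  moreover have "topspace (config_topology A) \<subseteq> \<Union> (U ` configs A)"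
    by (auto simp: U_def simp del: PiE_UNIV_domain)
  ultimately obtain \<F> where \<F>: "finite \<F>" "\<F> \<subseteq> U ` configs A"
      "topspace (config_topology A) \<subseteq> \<Union>\<F>"
    using compact_space_config_topology[OF finA] unfolding compact_space_alt by meson
  obtain B where B: "B \<subseteq> configs A" "finite B" "\<F> = U ` B"
    using finite_subset_image[OF \<F>(1,2)] by blast
  define L' where "L' = insert 0 L \<union> (\<Union>b\<in>B. K b)"
  show ?thesis
  proof
    show "finite L'" using B(2) finK L by (simp add: L'_def)
    show "L \<subseteq> L'" "0 \<in> L'" by (auto simp: L'_def)
    fix g E p assume p: "locally_valid A X W E p" and E: "(+) g ` L' \<subseteq> E"
    have pA: "p \<in> E \<rightarrow>\<^sub>E A"
      and pW: "\<And>g. (+) g ` W \<subseteq> E \<Longrightarrow> restrict (\<lambda>w. p (g + w)) W \<notin> forbidden A X W"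
      using p by (auto simp: locally_valid_iff)
    have gE: "g \<in> E" using E \<open>0 \<in> L'\<close> by force
    \<comment> \<open>The value \<open>p g\<close> off \<open>L'\<close> is padding: it makes
      \<open>y\<close> a configuration over \<open>A\<close>, and all comparisons take place inside
      \<open>L'\<close>.\<close>
    define y where "y = (\<lambda>v. if v \<in> L' then p (g + v) else p g)"
    have y: "y \<in> configs A" using pA gE E by (auto simp: y_def PiE_iff)
    then obtain b where b: "b \<in> B" "y \<in> U b" using \<F>(3) B(3) by auto
    have yb: "y m = b m" if "m \<in> K b" for m using b(2) that by (auto simp: U_def)
    have KL: "K b \<subseteq> L'" using b(1) by (auto simp: L'_def)
    have "b \<in> X"
    proof (rule ccontr)
      assume nb: "b \<notin> X"
      then have Kb: "K b = (+) (G b) ` W" by (simp add: K_def)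
      have "b (G b + w) = p (g + G b + w)" if "w \<in> W" for w
        using yb[of "G b + w"] KL that by (auto simp: Kb y_def add.assoc)
      then have "restrict (\<lambda>w. p (g + G b + w)) W = restrict (\<lambda>w. b (G b + w)) W"
        by (simp add: restrict_def fun_eq_iff)
      moreover have "(+) (g + G b) ` W \<subseteq> E" using KL E by (auto simp: Kb add.assoc)
      ultimately show False using pW[of "g + G b"] G[of b] nb b(1) B(1) by auto
    qed
    have "shift g b (g + l) = p (g + l)" if "l \<in> L" for l
      using yb[of l] that \<open>b \<in> X\<close> \<open>L \<subseteq> L'\<close> by (auto simp: K_def y_def shift_def add.assoc[symmetric])
    then show "\<exists>x\<in>X. \<forall>l\<in>L. x (g + l) = p (g + l)"
      using subshift_shift[OF X \<open>b \<in> X\<close>] by blast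
  qed
qed

text \<open>A locally valid pattern \<open>p'\<close> on a neighbourhood of \<open>D\<close> is contracted, away from \<open>D\<close>,
  to a fixed configuration \<open>y\<close> of \<open>X\<close>; by compactness the local rule of the contraction only ever
  sees globally valid patterns.\<close>

lemma contractible_imp_fep:
  fixes X :: "('g::group_add \<Rightarrow> 'a) set"
  assumes sft: "sft A X" and con: "contractible_shift A X"
  shows "fep A X"
proof -
  have X: "subshift A X" using sft by (simp add: sft_def)
  note XA = subshift_subset_configs[OF X]
  obtain W where win: "is_window A X W" using sft by (auto simp: sft_def)
  then have finW: "finite W" by (simp add: is_window_def)
  obtain h M where finM: "finite M"
    and hX: "\<And>i x y. i \<in> configs {0, 1 :: nat} \<Longrightarrow> x \<in> X \<Longrightarrow> y \<in> X \<Longrightarrow> h i x y \<in> X"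
    and h0: "\<And>x y. x \<in> X \<Longrightarrow> y \<in> X \<Longrightarrow> h (\<lambda>_. 0) x y = x"
    and h1: "\<And>x y. x \<in> X \<Longrightarrow> y \<in> X \<Longrightarrow> h (\<lambda>_. 1) x y = y"
    and hM: "\<And>i x y i' x' y' g. i \<in> configs {0, 1 :: nat} \<Longrightarrow> x \<in> X \<Longrightarrow> y \<in> X \<Longrightarrow>
       i' \<in> configs {0, 1 :: nat} \<Longrightarrow> x' \<in> X \<Longrightarrow> y' \<in> X \<Longrightarrow>
       \<forall>m\<in>M. i (g + m) = i' (g + m) \<and> x (g + m) = x' (g + m) \<and> y (g + m) = y' (g + m) \<Longrightarrow>
       h i x y g = h i' x' y' g"
    by (rule contractible_shift_memory[OF X con]) (rule that)
  define M' where "M' = insert 0 M"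
  \<comment> \<open>\<open>L\<close> contains all offsets that the local rule reads when it is
    evaluated on a whole window; with 0 in \<open>M'\<close> the region \<open>D + M'\<close>
    contains \<open>D\<close>.\<close>
  define L where "L = insert 0 W + M'"
  have finM': "finite M'" and finL: "finite L" using finM finW by (auto simp: M'_def L_def intro: finite_set_plus)
  have L0: "0 \<in> L" using set_plus_intro[of 0 "insert 0 W" 0 M'] by (simp add: L_def M'_def)
  have M'L: "m \<in> L" if "m \<in> M'" for m
    using set_plus_intro[of 0 "insert 0 W" m M'] that by (simp add: L_def)
  have WL: "w + m \<in> L" if "w \<in> W" "m \<in> M'" for w m
    using that by (auto simp: L_def)
  obtain L' where finL': "finite L'" and LL': "L \<subseteq> L'" and L'0: "0 \<in> L'"
    and L': "\<And>g E p. locally_valid A X W E p \<Longrightarrow> (+) g ` L' \<subseteq> E \<Longrightarrow>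
       \<exists>x\<in>X. \<forall>l\<in>L. x (g + l) = p (g + l)"
    by (rule locally_valid_compactness[OF X win finL]) (rule that)
  \<comment> \<open>If \<open>g + l\<close> lies in \<open>D + M'\<close>, then
    \<open>g = d + m - l\<close> for some \<open>d\<close> in \<open>D\<close>, and the set
    \<open>g + L'\<close> to which compactness applies lies in \<open>D + N\<close>.\<close>
  define N where "N = (\<lambda>(m, l, l'). m - l + l') ` (M' \<times> L \<times> L')"
  have N: "m - l + l' \<in> N" if "m \<in> M'" "l \<in> L" "l' \<in> L'" for m l l'
    using that unfolding N_def by (intro image_eqI[of _ _ "(m, l, l')"]) auto
  have finN: "finite N" using finM' finL finL' by (simp add: N_def)
  have M'0: "0 \<in> M'" by (simp add: M'_def)
  have N0: "0 \<in> N" using N[OF M'0 L0 L'0] by simp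
  have "globally_valid X D p"
    if D: "D \<noteq> {}" and pD: "p \<in> D \<rightarrow>\<^sub>E A" and lv: "locally_valid A X W (D + N) p'"
      and pp': "p = restrict p' D" for D p p'
  proof -
    define i :: "'g \<Rightarrow> nat" where "i = (\<lambda>v. if v \<in> D + M' then 0 else 1)"
    have iI: "i \<in> configs {0, 1 :: nat}" by (auto simp: i_def)
    have cI: "(\<lambda>_::'g. 0::nat) \<in> configs {0, 1}" "(\<lambda>_::'g. 1::nat) \<in> configs {0, 1}" by auto
    have near: "\<exists>x\<in>X. \<forall>l\<in>L. x (g + l) = p' (g + l)"
      if l: "l \<in> L" and gl: "g + l \<in> D + M'" for g l
    proof (rule L'[OF lv])
      obtain d m where dm: "d \<in> D" "m \<in> M'" "g + l = d + m" using gl by (auto simp: set_plus_def)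
      then have g: "g = d + (m - l)" by (metis add_diff_cancel add_diff_eq)
      show "(+) g ` L' \<subseteq> D + N"
        using N[OF dm(2) l] dm(1) by (auto simp: g add.assoc intro!: set_plus_intro)
    qed
    obtain d0 where d0: "d0 \<in> D" using D by blast
    have nearD: "\<exists>x\<in>X. \<forall>l\<in>L. x (d + l) = p' (d + l)" if "d \<in> D" for d
      using near[OF L0, of d] set_plus_intro[OF that M'0] by simp
    obtain y where y: "y \<in> X" using nearD[OF d0] by blast
    \<comment> \<open>Each site gets its own point \<open>xs v\<close> of \<open>X\<close> that
      imitates \<open>p'\<close> on \<open>v + M'\<close>, and an arbitrary point of
      \<open>X\<close> where none does.\<close>
    have "\<forall>v. \<exists>x. x \<in> X \<and>
      ((\<exists>x\<in>X. \<forall>m\<in>M'. x (v + m) = p' (v + m)) \<longrightarrow> (\<forall>m\<in>M'. x (v + m) = p' (v + m)))"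
      using y by blast
    from choice[OF this] obtain xs where xs: "\<And>v. xs v \<in> X \<and>
      ((\<exists>x\<in>X. \<forall>m\<in>M'. x (v + m) = p' (v + m)) \<longrightarrow> (\<forall>m\<in>M'. xs v (v + m) = p' (v + m)))"
      by iprover
    define z where "z = (\<lambda>v. h i (xs v) y v)"
    have zA: "z \<in> configs A"
    proof -
      have "h i (xs v) y \<in> configs A" for v
        using hX[OF iI conjunct1[OF xs] y, of v] XA by blast
      then show ?thesis by (simp add: z_def PiE_iff)
    qed
    have "z \<in> X"
    proof (rule window_config[OF win zA])
      fix g
      show "restrict (\<lambda>w. z (g + w)) W \<notin> forbidden A X W"
      \<comment> \<open>Either the window is close to \<open>D\<close>, and a single
        \<open>x\<close> can replace all the \<open>xs (g + w)\<close>, or \<open>i\<close> is 1 on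
        everything that is read and \<open>z\<close> equals \<open>y\<close> on the window.\<close>
      proof (cases "\<exists>l\<in>L. g + l \<in> D + M'")
        case True
        then obtain x where x: "x \<in> X" "\<forall>l\<in>L. x (g + l) = p' (g + l)" using near by blast
        have "z (g + w) = h i x y (g + w)" if w: "w \<in> W" for w
        proof -
          have *: "x (g + w + m) = p' (g + w + m)" if "m \<in> M'" for m
            using x(2) WL[OF w that] by (simp add: add.assoc)
          then have "xs (g + w) (g + w + m) = p' (g + w + m)" if "m \<in> M'" for m
            using xs[of "g + w"] x(1) that by blast
          with * show ?thesis unfolding z_def
            by (intro hM iI y x conjunct1[OF xs]) (auto simp: M'_def)
        qed
        then have "restrict (\<lambda>w. z (g + w)) W = restrict (\<lambda>w. h i x y (g + w)) W" by auto
        then show ?thesis using not_forbidden[OF hX[OF iI x(1) y]] by metis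
      next
        case False
        have "z (g + w) = y (g + w)" if w: "w \<in> W" for w
        proof -
          have "i (g + w + m) = 1" if "m \<in> M'" for m
            using False WL[OF w that] by (simp add: i_def add.assoc)
          then have "z (g + w) = h (\<lambda>_. 1) (xs (g + w)) y (g + w)"
            unfolding z_def by (intro hM iI cI y conjunct1[OF xs]) (auto simp: M'_def)
          then show ?thesis using h1 xs y by simp
        qed
        then have "restrict (\<lambda>w. z (g + w)) W = restrict (\<lambda>w. y (g + w)) W" by auto
        then show ?thesis using not_forbidden[OF y] by metis
      qed
    qed
    moreover have "z d = p d" if d: "d \<in> D" for d
    proof -
      have "\<exists>x\<in>X. \<forall>m\<in>M'. x (d + m) = p' (d + m)" using nearD[OF d] M'L by blast
      then have *: "xs d d = p' d" using conjunct2[OF xs[of d]] M'0 by (metis (no_types) add.right_neutral)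
      have "i (d + m) = 0" if "m \<in> M'" for m using d that by (auto simp: i_def)
      then have "z d = h (\<lambda>_. 0) (xs d) y d"
        unfolding z_def by (intro hM iI cI y conjunct1[OF xs]) (auto simp: M'_def)
      then show ?thesis using h0 xs y * d by (simp add: pp')
    qed
    then have "p = restrict z D" using pD by (auto simp: PiE_iff extensional_def)
    ultimately show ?thesis by (auto simp: globally_valid_def)
  qed
  then show ?thesis unfolding fep_def using sft win finN N0 by blast
qed

text \<open>Running the contraction with \<open>i\<close> equal to 0 around \<open>E\<close> and 1
  elsewhere joins preimages of the two points; \<open>M'\<close> is the combined reach of
  \<open>f\<close> after \<open>h\<close>.\<close>

lemma factor_strongly_irreducible:
  fixes X :: "('g::group_add \<Rightarrow> 'a) set"
  assumes X: "subshift A X" and con: "contractible_shift A X"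
    and f: "block_map A X B (f ` X) f"
  shows "strongly_irreducible S (f ` X)"
proof -
  note XA = subshift_subset_configs[OF X]
  obtain h M where finM: "finite M"
    and hX: "\<And>i x y. i \<in> configs {0, 1 :: nat} \<Longrightarrow> x \<in> X \<Longrightarrow> y \<in> X \<Longrightarrow> h i x y \<in> X"
    and h0: "\<And>x y. x \<in> X \<Longrightarrow> y \<in> X \<Longrightarrow> h (\<lambda>_. 0) x y = x"
    and h1: "\<And>x y. x \<in> X \<Longrightarrow> y \<in> X \<Longrightarrow> h (\<lambda>_. 1) x y = y"
    and hM: "\<And>i x y i' x' y' g. i \<in> configs {0, 1 :: nat} \<Longrightarrow> x \<in> X \<Longrightarrow> y \<in> X \<Longrightarrow>
       i' \<in> configs {0, 1 :: nat} \<Longrightarrow> x' \<in> X \<Longrightarrow> y' \<in> X \<Longrightarrow>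
       \<forall>m\<in>M. i (g + m) = i' (g + m) \<and> x (g + m) = x' (g + m) \<and> y (g + m) = y' (g + m) \<Longrightarrow>
       h i x y g = h i' x' y' g"
    by (rule contractible_shift_memory[OF X con]) (rule that)
  obtain K where finK: "finite K"
    and fK: "\<And>x x' g. x \<in> X \<Longrightarrow> x' \<in> X \<Longrightarrow> \<forall>m\<in>K. x (g + m) = x' (g + m) \<Longrightarrow> f x g = f x' g"
    by (rule block_map_memory[OF X f]) (rule that)
  define M' where "M' = K + M"
  have finM': "finite M'" using finK finM by (simp add: M'_def finite_set_plus)
  define len where "len = (\<lambda>v. LEAST n. \<exists>ws. length ws = n \<and> set ws \<subseteq> S \<and> sum_list ws = v)"
  \<comment> \<open>If \<open>a + M'\<close> and \<open>b + M'\<close> meet, then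
    \<open>- a + b\<close> is a difference of two elements of \<open>M'\<close>, so its word length
    is below \<open>R\<close>.\<close>
  define R where "R = Suc (Max (len ` (\<lambda>(m, m'). m - m') ` (M' \<times> M')))"
  have R: "len (m - m') < R" if "m \<in> M'" "m' \<in> M'" for m m'
    unfolding R_def less_Suc_eq_le using that finM' by (intro Max_ge) auto
  show ?thesis
    unfolding strongly_irreducible_def
  proof (intro exI[of _ R] allI impI ballI)
    fix E F y y' assume sep: "\<forall>a\<in>E. \<forall>b\<in>F. R \<le> word_metric S a b"
      and "y \<in> f ` X" "y' \<in> f ` X"
    then obtain x x' where x: "x \<in> X" "x' \<in> X" "y = f x" "y' = f x'" by blast
    define i :: "'g \<Rightarrow> nat" where "i = (\<lambda>v. if v \<in> E + M' then 0 else 1)"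
    have iI: "i \<in> configs {0, 1 :: nat}" by (auto simp: i_def)
    have cI: "(\<lambda>_::'g. 0::nat) \<in> configs {0, 1}" "(\<lambda>_::'g. 1::nat) \<in> configs {0, 1}" by auto
    define z where "z = h i x x'"
    have z: "z \<in> X" unfolding z_def by (intro hX iI x)
    have "f z a = f x a" if a: "a \<in> E" for a
    proof (intro fK z x ballI)
      fix k assume k: "k \<in> K"
      have "i (a + k + m) = 0" if "m \<in> M" for m
        using a k that by (auto simp: i_def M'_def add.assoc)
      then have "z (a + k) = h (\<lambda>_. 0) x x' (a + k)"
        unfolding z_def by (intro hM iI cI x) auto
      then show "z (a + k) = x (a + k)" using h0 x by simp
    qed
    moreover have "f z b = f x' b" if b: "b \<in> F" for b
    proof (intro fK z x ballI)
      fix k assume k: "k \<in> K"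
      have "i (b + k + m) = 1" if m: "m \<in> M" for m
      proof (rule ccontr)
        assume "i (b + k + m) \<noteq> 1"
        then have "b + k + m \<in> E + M'" by (auto simp: i_def split: if_splits)
        then obtain a m' where a: "a \<in> E" "m' \<in> M'" "b + k + m = a + m'" by (auto simp: set_plus_def)
        have "b + (k + m) = a + m'" using a(3) by (simp add: add.assoc)
        have "- a + b = - a + (b + (k + m)) - (k + m)" by (metis add.assoc add_diff_cancel)
        also have "\<dots> = m' - (k + m)" unfolding \<open>b + (k + m) = a + m'\<close> by simp
        finally have "- a + b = m' - (k + m)" .
        then have "word_metric S a b = len (m' - (k + m))" by (simp add: word_metric_def len_def)
        moreover have "k + m \<in> M'" using k m by (auto simp: M'_def)
        ultimately show False using R[OF a(2), of "k + m"] sep a(1) b by (metis not_less)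
      qed
      then have "z (b + k) = h (\<lambda>_. 1) x x' (b + k)"
        unfolding z_def by (intro hM iI cI x) auto
      then show "z (b + k) = x' (b + k)" using h1 x by simp
    qed
    ultimately show "\<exists>z\<in>f ` X. restrict z E = restrict y E \<and> restrict z F = restrict y' F"
      using z x by (intro bexI[of _ "f z"]) auto
  qed
qed

section \<open>An FEP subshift that is not contractible\<close>

text \<open>That a pattern is not forbidden only means that some point of \<open>X\<close> shows it
  somewhere, whence a site \<open>g'\<close> unrelated to \<open>g\<close>.\<close>

lemma not_forbidden_appears:
  assumes "p \<in> E \<rightarrow>\<^sub>E A" "(+) g ` W \<subseteq> E" "restrict (\<lambda>w. p (g + w)) W \<notin> forbidden A X W"
  obtains x g' where "x \<in> X" "\<And>w. w \<in> W \<Longrightarrow> x (g' + w) = p (g + w)"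
proof -
  have "restrict (\<lambda>w. p (g + w)) W \<in> W \<rightarrow>\<^sub>E A" using assms(1,2) by auto
  then obtain x where "x \<in> X" "appears_in W (restrict (\<lambda>w. p (g + w)) W) UNIV x"
    using assms(3) by (auto simp: forbidden_def)
  then obtain g' where "\<forall>w\<in>W. x (g' + w) = p (g + w)" by (auto simp: appears_in_def)
  then show ?thesis using that[OF \<open>x \<in> X\<close>, of g'] by simp
qed

text \<open>Read \<open>k\<close> as the horizontal and \<open>l\<close> as the vertical direction.\<close>

definition stripe_free :: "'n \<Rightarrow> 'n \<Rightarrow> 'a set \<Rightarrow> (int ^ 'n \<Rightarrow> 'a) set" where
  "stripe_free k l A = {x \<in> configs A. \<forall>g. x g = x (g + axis k 1) \<longrightarrow>
     x (g + axis l 1) = x (g + axis l 1 + axis k 1) \<longrightarrow> x g = x (g + axis l 1)}"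

lemma stripe_free_window:
  fixes A :: "'a set" and k l :: "'n::finite"
  assumes "finite A"
  defines "W \<equiv> {0, axis k 1, axis l 1, axis l 1 + axis k 1} :: (int ^ 'n) set"
  shows "is_window A (stripe_free k l A) W" "sft A (stripe_free k l A)"
proof -
  let ?P = "\<lambda>x::int ^ 'n \<Rightarrow> 'a. x 0 = x (axis k 1) \<longrightarrow>
     x (axis l 1) = x (axis l 1 + axis k 1) \<longrightarrow> x 0 = x (axis l 1)"
  have W: "finite W" by (simp add: W_def)
  have loc: "?P x \<Longrightarrow> ?P y" if "\<forall>w\<in>W. x w = y w" for x y
    using that by (simp add: W_def)
  have X: "stripe_free k l A = {x \<in> configs A. \<forall>g. ?P (\<lambda>h. x (g + h))}"
    by (simp add: stripe_free_def add.assoc)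
  show "is_window A (stripe_free k l A) W" "sft A (stripe_free k l A)"
    by (rule sft_localI[OF assms(1) W loc X]; assumption)+
qed

text \<open>With three symbols one may always choose a symbol different from both horizontal
  neighbours: first at the sites with even, then at those with odd coordinate.\<close>

lemma stripe_free_fep:
  fixes A :: "'a set" and k l :: "'n::finite"
  assumes A: "finite A" "card A \<ge> 3"
  shows "fep A (stripe_free k l A)"
proof -
  define W where "W = ({0, axis k 1, axis l 1, axis l 1 + axis k 1} :: (int ^ 'n) set)"
  let ?X = "stripe_free k l A" and ?e = "axis k 1 :: int ^ 'n"
  have win: "is_window A ?X W" and sft: "sft A ?X"
    using stripe_free_window[OF A(1), of k l] by (simp_all add: W_def)
  have "\<exists>u. u \<in> A \<and> u \<noteq> s \<and> u \<noteq> t" for s t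
  proof -
    have "card (A - {s, t}) \<ge> card A - card {s, t}" by (rule diff_card_le_card_Diff) simp
    moreover have "card {s, t} \<le> 2" by (simp add: card_insert_if)
    ultimately have "card (A - {s, t}) \<noteq> 0" using A(2) by linarith
    then have "A - {s, t} \<noteq> {}" by (metis card.empty)
    then show ?thesis by blast
  qed
  then obtain fr where fr: "\<And>s t. fr s t \<in> A" "\<And>s t. fr s t \<noteq> s" "\<And>s t. fr s t \<noteq> t"
    by metis
  have "globally_valid ?X D p'"
    if lv: "locally_valid A ?X W D p'" for D p'
  proof -
    have pA: "p' \<in> D \<rightarrow>\<^sub>E A" using lv by (simp add: locally_valid_iff)
    \<comment> \<open>Off \<open>D\<close> the pattern \<open>p'\<close> has junk values; avoiding
      these too does no harm, and neighbours inside \<open>D\<close> are avoided for certain. The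
      odd sites then avoid the final values of their even neighbours.\<close>
    define z1 where "z1 = (\<lambda>v. if v \<in> D then p' v else fr (p' (v + ?e)) (p' (v - ?e)))"
    define z where "z = (\<lambda>v. if v \<in> D \<or> even (v $ k) then z1 v else fr (z1 (v + ?e)) (z1 (v - ?e)))"
    have zD: "z v = p' v" if "v \<in> D" for v using that by (simp add: z_def z1_def)
    have zA: "z \<in> configs A" using pA fr(1) by (auto simp: z_def z1_def PiE_iff)
    have par: "even ((v + ?e) $ k) \<longleftrightarrow> odd (v $ k)" "even ((v - ?e) $ k) \<longleftrightarrow> odd (v $ k)" for v
      by (simp_all add: axis_def)
    have nb: "z v \<noteq> z (v + ?e)" "z v \<noteq> z (v - ?e)" if v: "v \<notin> D" for v
    proof -
      have "z v \<noteq> z (v + ?e) \<and> z v \<noteq> z (v - ?e)"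
      proof (cases "even (v $ k)")
        case True
        then have zv: "z v = z1 v" by (simp add: z_def)
        have "z (v + ?e) \<noteq> z1 v"
        proof (cases "v + ?e \<in> D")
          case True then show ?thesis using v fr(2)[of "p' (v + ?e)" "p' (v - ?e)"]
            by (simp add: zD z1_def)
        next
          case False then show ?thesis using True par(1)[of v] fr(3) by (simp add: z_def)
        qed
        moreover have "z (v - ?e) \<noteq> z1 v"
        proof (cases "v - ?e \<in> D")
          case True then show ?thesis using v fr(3)[of "p' (v + ?e)" "p' (v - ?e)"]
            by (simp add: zD z1_def)
        next
          case False then show ?thesis using True par(2)[of v] fr(2) by (simp add: z_def)
        qed
        ultimately show ?thesis using zv by metis
      next
        case False
        then have "z v = fr (z1 (v + ?e)) (z1 (v - ?e))" using v by (simp add: z_def)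
        moreover have "z (v + ?e) = z1 (v + ?e)" "z (v - ?e) = z1 (v - ?e)"
          using False par[of v] by (simp_all add: z_def)
        ultimately show ?thesis using fr(2,3) by metis
      qed
      then show "z v \<noteq> z (v + ?e)" "z v \<noteq> z (v - ?e)" by auto
    qed
    have "z \<in> ?X"
      unfolding stripe_free_def
    proof (intro CollectI conjI allI impI zA, rule ccontr)
      fix g assume eq1: "z g = z (g + ?e)" and eq2: "z (g + axis l 1) = z (g + axis l 1 + ?e)"
        and ne: "z g \<noteq> z (g + axis l 1)"
      \<comment> \<open>A filled site differs from both horizontal neighbours, whereas a violation
        consists of two horizontal pairs of equal symbols; so it lies inside \<open>D\<close>, where
        \<open>p'\<close> is locally valid.\<close>
      have D: "v \<in> D" "v + ?e \<in> D" if "z v = z (v + ?e)" for v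
        using nb(1)[of v] nb(2)[of "v + ?e"] that by auto
      have gW: "(+) g ` W \<subseteq> D" using D[OF eq1] D[OF eq2] by (auto simp: W_def add.assoc)
      then have "restrict (\<lambda>w. p' (g + w)) W \<notin> forbidden A ?X W"
        using lv by (simp add: locally_valid_iff)
      then obtain x g' where x: "x \<in> ?X" "\<And>w. w \<in> W \<Longrightarrow> x (g' + w) = p' (g + w)"
        using not_forbidden_appears[OF pA gW] by metis
      have xz: "x (g' + w) = z (g + w)" if "w \<in> W" for w
        using x(2)[OF that] zD[of "g + w"] gW that by auto
      have xg: "x g' = z g" "x (g' + ?e) = z (g + ?e)" "x (g' + axis l 1) = z (g + axis l 1)"
        "x (g' + axis l 1 + ?e) = z (g + axis l 1 + ?e)"
        using xz[of 0] xz[of ?e] xz[of "axis l 1"] xz[of "axis l 1 + ?e"]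
        by (simp_all add: W_def add.assoc)
      then have "x g' = x (g' + ?e)" "x (g' + axis l 1) = x (g' + axis l 1 + ?e)"
        using eq1 eq2 by simp_all
      then have "x g' = x (g' + axis l 1)" using x(1) unfolding stripe_free_def by blast
      then show False using xg ne by simp
    qed
    moreover have "p' = restrict z D" using pA zD by (auto simp: PiE_iff extensional_def)
    ultimately show ?thesis by (auto simp: globally_valid_def)
  qed
  note gv = this
  have D0: "D + {0} = D" for D :: "(int ^ 'n) set" by (auto simp: set_plus_def)
  have "globally_valid ?X D p"
    if "locally_valid A ?X W (D + {0}) p'" "p = restrict p' D" for D p p'
  proof -
    have "p = p'" using that by (auto simp: D0 locally_valid_iff intro: PiE_restrict)
    then show ?thesis using gv that(1) by (simp add: D0)
  qed
  moreover have "finite {0 :: int ^ 'n} \<and> 0 \<in> {0 :: int ^ 'n}" by simp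
  ultimately show ?thesis unfolding fep_def using sft win by blast
qed

lemma finite_coordinate_bound:
  fixes M :: "(int ^ 'n) set"
  assumes "finite M"
  obtains r where "r \<ge> 0" "\<And>m i. m \<in> M \<Longrightarrow> \<bar>m $ i\<bar> \<le> r"
proof
  let ?S = "(\<lambda>(m, i). \<bar>m $ i\<bar>) ` (M \<times> UNIV)"
  have fin: "finite (insert 0 ?S)" using assms by simp
  show "0 \<le> Max (insert 0 ?S)" using fin by simp
  fix m i assume "m \<in> M"
  then show "\<bar>m $ i\<bar> \<le> Max (insert 0 ?S)" using fin by (intro Max_ge) (auto intro: image_eqI[of _ _ "(m, i)"])
qed

text \<open>A horizontally constant interpolation between the two fixed points \<open>a\<close> and \<open>b\<close> would be
  constant.\<close>

lemma stripe_free_not_contractible: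
  fixes A :: "'a set" and k l :: "'n::finite"
  assumes finA: "finite A" and ab: "a \<in> A" "b \<in> A" "a \<noteq> b" and kl: "k \<noteq> l"
  shows "\<not> contractible_shift A (stripe_free k l A)"
proof
  let ?X = "stripe_free k l A"
  assume con: "contractible_shift A ?X"
  have X: "subshift A ?X" using stripe_free_window(2)[OF finA, of k l] by (simp add: sft_def)
  obtain h M where finM: "finite M"
    and hX: "\<And>i x y. i \<in> configs {0, 1 :: nat} \<Longrightarrow> x \<in> ?X \<Longrightarrow> y \<in> ?X \<Longrightarrow> h i x y \<in> ?X"
    and eqv: "\<And>i x y g. i \<in> configs {0, 1 :: nat} \<Longrightarrow> x \<in> ?X \<Longrightarrow> y \<in> ?X \<Longrightarrow>
       h (shift g i) (shift g x) (shift g y) = shift g (h i x y)"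
    and h0: "\<And>x y. x \<in> ?X \<Longrightarrow> y \<in> ?X \<Longrightarrow> h (\<lambda>_. 0) x y = x"
    and h1: "\<And>x y. x \<in> ?X \<Longrightarrow> y \<in> ?X \<Longrightarrow> h (\<lambda>_. 1) x y = y"
    and hM: "\<And>i x y i' x' y' g. i \<in> configs {0, 1 :: nat} \<Longrightarrow> x \<in> ?X \<Longrightarrow> y \<in> ?X \<Longrightarrow>
       i' \<in> configs {0, 1 :: nat} \<Longrightarrow> x' \<in> ?X \<Longrightarrow> y' \<in> ?X \<Longrightarrow>
       \<forall>m\<in>M. i (g + m) = i' (g + m) \<and> x (g + m) = x' (g + m) \<and> y (g + m) = y' (g + m) \<Longrightarrow>
       h i x y g = h i' x' y' g"
    by (rule contractible_shift_memory[OF X con]) (rule that)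
  let ?a = "\<lambda>_::int ^ 'n. a" and ?b = "\<lambda>_::int ^ 'n. b"
  have abX: "?a \<in> ?X" "?b \<in> ?X" using ab by (auto simp: stripe_free_def)
  \<comment> \<open>The switch depends on the vertical coordinate only, so \<open>z\<close> inherits
    the invariance under horizontal shifts.\<close>
  define i :: "int ^ 'n \<Rightarrow> nat" where "i = (\<lambda>v. if v $ l < 0 then 0 else 1)"
  have iI: "i \<in> configs {0, 1 :: nat}" by (auto simp: i_def)
  have cI: "(\<lambda>_::int ^ 'n. 0::nat) \<in> configs {0, 1}" "(\<lambda>_::int ^ 'n. 1::nat) \<in> configs {0, 1}" by auto
  define z where "z = h i ?a ?b"
  have zX: "z \<in> ?X" unfolding z_def by (intro hX iI abX)
  have "shift (- axis k 1) i = i" using kl by (auto simp: shift_def i_def axis_def fun_eq_iff)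
  then have "shift (- axis k 1) z = z"
    using eqv[OF iI abX, of "- axis k 1"] by (simp add: z_def shift_def)
  then have "z (axis k 1 + v) = z v" for v by (metis shift_minus_apply)
  then have "z v = z (v + axis k 1)" for v by (simp add: add.commute)
  then have step: "z v = z (v + axis l 1)" for v
    using zX unfolding stripe_free_def by blast
  have axis_add: "axis l s + axis l 1 = (axis l (s + 1) :: int ^ 'n)" for s
    by (simp add: axis_def vec_eq_iff)
  have const: "z (axis l s) = z (axis l 0)" for s
  proof (induction s rule: int_induct[of _ 0])
    case (step1 s) then show ?case using step[of "axis l s"] by (simp add: axis_add)
  next
    case (step2 s) then show ?case using step[of "axis l (s - 1)"] by (simp add: axis_add)
  qed simp
  obtain r where r: "r \<ge> 0" "\<And>m i. m \<in> M \<Longrightarrow> \<bar>m $ i\<bar> \<le> r"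
    using finite_coordinate_bound[OF finM] by blast
  \<comment> \<open>From height \<open>- r - 1\<close> only negative heights are read, from height
    \<open>r\<close> only nonnegative ones; there \<open>z\<close> shows \<open>a\<close> and
    \<open>b\<close> respectively.\<close>
  have "i (axis l (- r - 1) + m) = 0" if "m \<in> M" for m
    using r(2)[OF that, of l] by (simp add: i_def axis_def)
  then have "z (axis l (- r - 1)) = h (\<lambda>_. 0) ?a ?b (axis l (- r - 1))"
    unfolding z_def by (intro hM iI cI abX) auto
  moreover have "i (axis l r + m) = 1" if "m \<in> M" for m
    using r(2)[OF that, of l] by (simp add: i_def axis_def)
  then have "z (axis l r) = h (\<lambda>_. 1) ?a ?b (axis l r)"
    unfolding z_def by (intro hM iI cI abX) auto
  ultimately show False using h0 h1 abX const[of "- r - 1"] const[of r] ab(3) by simp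
qed

lemma two_directions:
  assumes "CARD('n::finite) \<ge> 2"
  obtains k l :: "'n::finite" where "k \<noteq> l"
  using assms by (metis One_nat_def card_le_Suc0_iff_eq finite_class.finite_UNIV
      not_less_eq_eq numeral_2_eq_2 UNIV_I)

lemma contractible_SFTs_psubset_FEP:
  assumes "CARD('n::finite) \<ge> 2"
  shows "(contractible_SFTs :: (int ^ 'n, 'a::infinite) shift_space set) \<subset> FEP_subshifts"
proof
  show "(contractible_SFTs :: (int ^ 'n, 'a) shift_space set) \<subseteq> FEP_subshifts"
    by (auto simp: contractible_SFTs_def FEP_subshifts_def contractible_imp_fep)
  obtain k l :: 'n where kl: "k \<noteq> l"
    using two_directions[OF assms] .
  obtain A :: "'a set" where A: "finite A" "card A = 3"
    using infinite_arbitrarily_large[OF infinite_UNIV] by blast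
  then obtain a b where ab: "a \<in> A" "b \<in> A" "a \<noteq> b"
    by (auto simp: card_3_iff)
  have "(A, stripe_free k l A) \<in> FEP_subshifts"
    using stripe_free_fep[OF A(1)] A(2) by (simp add: FEP_subshifts_def)
  moreover have "(A, stripe_free k l A) \<notin> contractible_SFTs"
    using stripe_free_not_contractible[OF A(1) ab kl] by (simp add: contractible_SFTs_def)
  ultimately show "(contractible_SFTs :: (int ^ 'n, 'a) shift_space set) \<noteq> FEP_subshifts"
    by blast
qed

section \<open>A factor of a full shift without the finite extension property\<close>

lemma fepE:
  assumes "fep A X"
  obtains W N where "is_window A X W" "finite N" "0 \<in> N"
    "\<And>D p. D \<noteq> {} \<Longrightarrow> locally_valid A X W (D + N) p \<Longrightarrow> globally_valid X D (restrict p D)"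
proof -
  from assms obtain W N where W: "is_window A X W" and N: "finite N" "0 \<in> N"
    and ext: "\<forall>D p. D \<noteq> {} \<and> p \<in> D \<rightarrow>\<^sub>E A \<and>
      (\<exists>p'. locally_valid A X W (D + N) p' \<and> p = restrict p' D) \<longrightarrow> globally_valid X D p"
    unfolding fep_def by (elim exE conjE) (rule that)
  show ?thesis
  proof (rule that[OF W N])
    fix D p assume D: "D \<noteq> {}" and p: "locally_valid A X W (D + N) p"
    have "D \<subseteq> D + N" using set_plus_intro[of _ D 0 N] N(2) by auto
    then have "restrict p D \<in> D \<rightarrow>\<^sub>E A" using p by (auto simp: locally_valid_iff)
    then show "globally_valid X D (restrict p D)" using ext D p by blast
  qed
qed

text \<open>Inequality of booleans is addition modulo 2, so the recursion can be solved both upwards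
  and downwards from 0.\<close>

lemma int_antiderivative_mod_2:
  fixes a :: "int \<Rightarrow> bool"
  shows "\<exists>A. \<not> A 0 \<and> (\<forall>n. A (n + 1) = (A n \<noteq> a n))"
proof -
  define P where "P = rec_nat False (\<lambda>n b. b \<noteq> a (int n))"
  define Q where "Q = rec_nat False (\<lambda>n b. b \<noteq> a (- int n - 1))"
  define A where "A = (\<lambda>n. if n \<ge> 0 then P (nat n) else Q (nat (- n)))"
  have "A (n + 1) = (A n \<noteq> a n)" for n
  proof (cases "n \<ge> 0")
    case True
    then have "nat (n + 1) = Suc (nat n)" by simp
    then show ?thesis using True by (simp add: A_def P_def)
  next
    case False
    then obtain m where m: "n = - int m - 1"
      by (metis add.commute diff_minus_eq_add int_cases minus_diff_eq not_le uminus_add_conv_diff of_nat_0_le_iff of_nat_Suc)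
    then have "nat (- n) = Suc m" by simp
    then have "A n = (Q m \<noteq> a n)" using False by (simp add: A_def Q_def m)
    moreover have "A (n + 1) = Q m" by (simp add: A_def m P_def Q_def)
    ultimately show ?thesis by blast
  qed
  moreover have "\<not> A 0" by (simp add: A_def P_def)
  ultimately show ?thesis by blast
qed

text \<open>The Poincare lemma modulo 2: integrate \<open>p\<close> along \<open>k\<close> at height
  0, then \<open>q\<close> along \<open>l\<close>. The remaining coordinates are parameters.\<close>

lemma flat_imp_gradient:
  fixes p q :: "int ^ 'n::finite \<Rightarrow> bool" and k l :: 'n
  assumes kl: "k \<noteq> l"
    and flat: "\<And>g. (p g \<noteq> q (g + axis k 1)) = (q g \<noteq> p (g + axis l 1))"
  shows "\<exists>x :: int ^ 'n \<Rightarrow> bool. \<forall>g. p g = (x g \<noteq> x (g + axis k 1)) \<and> q g = (x g \<noteq> x (g + axis l 1))"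
proof -
  obtain I :: "(int \<Rightarrow> bool) \<Rightarrow> int \<Rightarrow> bool" where I: "\<And>a. \<not> I a 0" "\<And>a n. I a (n + 1) = (I a n \<noteq> a n)"
    using int_antiderivative_mod_2 by metis
  define col where "col = (\<lambda>g t. g + axis l (t - g $ l) :: int ^ 'n)"
  define F where "F = (\<lambda>g t. q (col g t))"
  define G where "G = (\<lambda>g s. p (col (g + axis k (s - g $ k)) 0))"
  define x where "x = (\<lambda>g. I (G g) (g $ k) \<noteq> I (F g) (g $ l))"
  have col_self: "col g (g $ l) = g" for g by (simp add: col_def vec_eq_iff axis_def)
  have col_l: "col (g + axis l 1) t = col g t" for g t
    by (simp add: col_def vec_eq_iff axis_def)
  have col_k: "col (g + axis k 1) t = col g t + axis k 1" for g t
    using kl by (simp add: col_def vec_eq_iff axis_def)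
  have col_Suc: "col g (t + 1) = col g t + axis l 1" for g t
    by (simp add: col_def vec_eq_iff axis_def)
  have Gl: "G (g + axis l 1) = G g" for g
    using kl by (simp add: G_def col_def vec_eq_iff axis_def fun_eq_iff) (intro allI arg_cong[of _ _ p], auto simp: vec_eq_iff)
  have Gk: "G (g + axis k 1) = G g" for g
  proof -
    have "g + axis k 1 + axis k (s - (g + axis k 1) $ k) = g + axis k (s - g $ k)" for s
      by (simp add: vec_eq_iff axis_def)
    then show ?thesis by (simp only: G_def)
  qed
  have Gself: "G g (g $ k) = p (col g 0)" for g
  proof -
    have "g + axis k (g $ k - g $ k) = g" by (simp add: vec_eq_iff axis_def)
    then show ?thesis by (simp only: G_def)
  qed
  have xq: "q g = (x g \<noteq> x (g + axis l 1))" for g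
  proof -
    have "F (g + axis l 1) = F g" by (simp add: F_def col_l)
    moreover have "(g + axis l 1) $ k = g $ k" "(g + axis l 1) $ l = g $ l + 1"
      using kl by (simp_all add: axis_def)
    moreover have "F g (g $ l) = q g" by (simp add: F_def col_self)
    ultimately show ?thesis by (auto simp: x_def Gl I(2))
  qed
  have xp: "p g = (x g \<noteq> x (g + axis k 1))" for g
  proof -
    let ?F' = "F (g + axis k 1)"
    \<comment> \<open>The \<open>k\<close>-edge at height \<open>n\<close> differs from the one at
      height 0 by the \<open>l\<close>-edges accumulated on the two adjacent columns; flatness of
      one square is the induction step.\<close>
    let ?C = "\<lambda>n. p (col g n) = (p (col g 0) \<noteq> (I (F g) n \<noteq> I ?F' n))"
    have step: "?C (n + 1) = ?C n" for n
      using flat[of "col g n"] by (auto simp: I(2) F_def col_Suc col_k)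
    have "?C n" for n
    proof (induction n rule: int_induct[of _ 0])
      case base then show ?case using I(1) by simp
    next
      case (step1 n) then show ?case using step[of n] by blast
    next
      case (step2 n) then show ?case using step[of "n - 1"] by simp
    qed
    from this[of "g $ l"] have "p g = (p (col g 0) \<noteq> (I (F g) (g $ l) \<noteq> I ?F' (g $ l)))"
      by (simp add: col_self)
    moreover have "(g + axis k 1) $ k = g $ k + 1" "(g + axis k 1) $ l = g $ l"
      using kl by (simp_all add: axis_def)
    moreover have "I (G g) (g $ k + 1) = (I (G g) (g $ k) \<noteq> p (col g 0))"
      unfolding I(2) Gself ..
    ultimately show ?thesis unfolding x_def Gk by (simp only:) blast
  qed
  show ?thesis by (intro exI[of _ x] allI conjI xp xq)
qed

text \<open>Flat \<open>\<int>/2\<close>-valued connections along the directions \<open>k\<close> and \<open>l\<close>: the symbol at \<open>g\<close>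
  records the values on the edges from \<open>g\<close> to \<open>g + axis k 1\<close> and from \<open>g\<close> to \<open>g + axis l 1\<close>.\<close>

definition flat_shift ::
  "'n \<Rightarrow> 'n \<Rightarrow> 'a set \<Rightarrow> ('a \<Rightarrow> bool \<times> bool) \<Rightarrow> (int ^ 'n \<Rightarrow> 'a) set" where
  "flat_shift k l A dec = {y \<in> configs A. \<forall>g.
     (fst (dec (y g)) \<noteq> snd (dec (y (g + axis k 1)))) =
     (snd (dec (y g)) \<noteq> fst (dec (y (g + axis l 1))))}"

definition gradient ::
  "'n \<Rightarrow> 'n \<Rightarrow> (bool \<times> bool \<Rightarrow> 'a) \<Rightarrow> (int ^ 'n \<Rightarrow> bool) \<Rightarrow> int ^ 'n \<Rightarrow> 'a" where
  "gradient k l enc x = (\<lambda>g. enc (x g \<noteq> x (g + axis k 1), x g \<noteq> x (g + axis l 1)))"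

lemma gradient_in_flat_shift:
  fixes enc :: "bool \<times> bool \<Rightarrow> 'a" and k l :: "'n::finite"
  assumes "\<And>b. dec (enc b) = b"
  shows "gradient k l enc x \<in> flat_shift k l (range enc) dec"
proof -
  have eq: "g + axis k 1 + axis l 1 = g + axis l 1 + axis k 1" for g :: "int ^ 'n"
    by (simp add: add_ac)
  show ?thesis
    unfolding flat_shift_def
  proof (intro CollectI conjI allI)
    show "gradient k l enc x \<in> configs (range enc)" by (auto simp: gradient_def)
    fix g
    show "(fst (dec (gradient k l enc x g)) \<noteq> snd (dec (gradient k l enc x (g + axis k 1)))) =
        (snd (dec (gradient k l enc x g)) \<noteq> fst (dec (gradient k l enc x (g + axis l 1))))"
      by (simp only: gradient_def assms fst_conv snd_conv eq) argo
  qed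
qed

lemma flat_shift_sft:
  fixes k l :: "'n::finite"
  assumes "finite A"
  shows "sft A (flat_shift k l A dec)"
proof -
  let ?P = "\<lambda>y::int ^ 'n \<Rightarrow> _. (fst (dec (y 0)) \<noteq> snd (dec (y (axis k 1)))) =
     (snd (dec (y 0)) \<noteq> fst (dec (y (axis l 1))))"
  let ?W = "{0, axis k 1, axis l 1} :: (int ^ 'n) set"
  have W: "finite ?W" by simp
  have loc: "?P x \<Longrightarrow> ?P y" if "\<forall>w\<in>?W. x w = y w" for x y
    using that by simp
  have X: "flat_shift k l A dec = {x \<in> configs A. \<forall>g. ?P (\<lambda>h. x (g + h))}"
    by (simp add: flat_shift_def)
  show ?thesis
    by (rule sft_localI(2)[OF assms W loc X]; assumption)
qed

lemma flat_shift_eq_gradients: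
  fixes k l :: "'n::finite" and enc :: "bool \<times> bool \<Rightarrow> 'a"
  assumes kl: "k \<noteq> l" and dec: "\<And>b. dec (enc b) = b"
  shows "flat_shift k l (range enc) dec = range (gradient k l enc)"
proof (intro equalityI subsetI)
  fix y assume y: "y \<in> flat_shift k l (range enc) dec"
  have "(fst (dec (y g)) \<noteq> snd (dec (y (g + axis k 1)))) =
      (snd (dec (y g)) \<noteq> fst (dec (y (g + axis l 1))))" for g
    using y by (simp add: flat_shift_def)
  from flat_imp_gradient[OF kl this] obtain x :: "int ^ 'n \<Rightarrow> bool"
    where x: "\<forall>g. fst (dec (y g)) = (x g \<noteq> x (g + axis k 1)) \<and>
      snd (dec (y g)) = (x g \<noteq> x (g + axis l 1))" ..
  have "y g = gradient k l enc x g" for g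
  proof -
    have "y g \<in> range enc" using y by (auto simp: flat_shift_def)
    then have "y g = enc (fst (dec (y g)), snd (dec (y g)))" using dec by auto
    then show ?thesis unfolding gradient_def using x by simp
  qed
  then have "y = gradient k l enc x" by blast
  then show "y \<in> range (gradient k l enc)" by blast
qed (use gradient_in_flat_shift[where dec=dec, OF dec] in blast)

text \<open>Without constraints two configurations can be spliced site by site.\<close>

lemma contractible_full_shift:
  fixes A :: "'a set"
  shows "contractible_shift A (configs A :: ('g::group_add \<Rightarrow> 'a) set)"
proof (rule contractible_shift_local_map)
  show "local_map (\<lambda>t (g::'g). case t g of (i::nat, x::'a, y) \<Rightarrow> if i = 0 then x else y)"
    by (rule local_map_pointwise)
qed (auto simp: PiE_iff)

lemma flat_shift_factor:
  fixes k l :: "'n::finite" and enc :: "bool \<times> bool \<Rightarrow> 'a"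
  assumes kl: "k \<noteq> l" and dec: "\<And>b. dec (enc b) = b"
  shows "(range enc, flat_shift k l (range enc) dec) \<in> SFT_factors_of_contractible_SFTs"
proof -
  let ?A = "range enc" and ?Y = "flat_shift k l (range enc) dec"
  have fin: "finite ?A" by simp
  have "sft ?A (configs ?A :: (int ^ 'n \<Rightarrow> 'a) set)"
    by (rule sft_localI(2)[OF fin, of "{}" "\<lambda>_. True"]) auto
  then have X: "(?A, configs ?A :: (int ^ 'n \<Rightarrow> 'a) set) \<in> contractible_SFTs"
    by (simp add: contractible_SFTs_def contractible_full_shift del: PiE_UNIV_domain)
  \<comment> \<open>The potential is stored in the first bit of the symbols, so that the full shift
    over the alphabet of \<open>flat_shift\<close> itself can serve as cover.\<close>
  define f where "f = (\<lambda>x::int ^ 'n \<Rightarrow> 'a. gradient k l enc (\<lambda>g. fst (dec (x g))))"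
  have loc: "local_map f"
  proof (rule local_mapI)
    show "finite {0, axis k 1, axis l 1 :: int ^ 'n}" by simp
    fix x x' :: "int ^ 'n \<Rightarrow> 'a" and g g'
    assume "\<And>m. m \<in> {0, axis k 1, axis l 1} \<Longrightarrow> x (g + m) = x' (g' + m)"
    from this[of 0] this[of "axis k 1"] this[of "axis l 1"] show "f x g = f x' g'"
      by (simp add: f_def gradient_def)
  qed
  have im: "f ` configs ?A = ?Y"
  proof -
    have "gradient k l enc x \<in> f ` configs ?A" for x
      by (rule image_eqI[of _ _ "\<lambda>g. enc (x g, False)"]) (auto simp: f_def dec)
    then show ?thesis unfolding flat_shift_eq_gradients[where dec=dec, OF kl dec] by (auto simp: f_def)
  qed
  have "block_map ?A (configs ?A) ?A ?Y f"
  proof (rule block_map_local_map[OF loc])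
    show "?Y \<subseteq> configs ?A" by (auto simp: flat_shift_def)
    show "f x \<in> ?Y" if "x \<in> configs ?A" for x using im that by blast
  qed simp
  then show ?thesis
    using X im flat_shift_sft[OF fin, of k l dec] unfolding SFT_factors_of_contractible_SFTs_def by blast
qed

lemma constant_on_int_interval:
  fixes f :: "int \<Rightarrow> 'a"
  assumes "a \<le> b" "\<And>t. a \<le> t \<Longrightarrow> t < b \<Longrightarrow> f (t + 1) = f t"
  shows "f b = f a"
proof -
  have "t \<le> b \<longrightarrow> f t = f a" if "a \<le> t" for t
    using that by (induction t rule: int_ge_induct) (use assms(2) in auto)
  then show ?thesis using assms(1) by blast
qed

text \<open>The connection that is nontrivial exactly on the edges crossing a half line has nonzero
  holonomy around the origin, but away from the origin it is locally a gradient.\<close>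

lemma flat_shift_not_fep:
  fixes k l :: "'n::finite" and enc :: "bool \<times> bool \<Rightarrow> 'a"
  assumes kl: "k \<noteq> l" and dec: "\<And>b. dec (enc b) = b"
  shows "\<not> fep (range enc) (flat_shift k l (range enc) dec)"
proof
  let ?A = "range enc" and ?Y = "flat_shift k l (range enc) dec"
  assume "fep ?A ?Y"
  then obtain W N where win: "is_window ?A ?Y W" and finN: "finite N" and N0: "0 \<in> N"
    and ext: "\<And>D p. D \<noteq> {} \<Longrightarrow> locally_valid ?A ?Y W (D + N) p \<Longrightarrow>
      globally_valid ?Y D (restrict p D)"
    by (rule fepE) (rule that)
  have "finite (W \<union> N)" using win finN by (simp add: is_window_def)
  from finite_coordinate_bound[OF this] obtain r where r: "r \<ge> 0"
      "\<And>m i. m \<in> W \<union> N \<Longrightarrow> \<bar>m $ i\<bar> \<le> r" by blast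
  \<comment> \<open>Two sites of one window differ by at most \<open>2 * r\<close> in each
    coordinate, so a coordinate of absolute value at least \<open>L\<close> keeps its sign across
    the window.\<close>
  define L where "L = 2 * r + 1"
  define far where "far = (\<lambda>K. {v::int ^ 'n. \<bar>v $ k\<bar> \<ge> K \<or> \<bar>v $ l\<bar> \<ge> K})"
  \<comment> \<open>In dimension above two the half line becomes a half hyperplane, and the hole
    consists of the sites near its boundary.\<close>
  define P where "P = (\<lambda>v::int ^ 'n. enc (False, v $ l = 0 \<and> v $ k > 0))"
  let ?D = "far (L + r)"
  have DN: "?D + N \<subseteq> far L"
  proof
    fix v assume "v \<in> ?D + N"
    then obtain d n where dn: "d \<in> ?D" "n \<in> N" "v = d + n" by (auto simp: set_plus_def)
    have "\<bar>n $ k\<bar> \<le> r" "\<bar>n $ l\<bar> \<le> r" using r(2) dn(2) by auto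
    moreover have "v $ k = d $ k + n $ k" "v $ l = d $ l + n $ l" using dn(3) by simp_all
    ultimately show "v \<in> far L" using dn(1) unfolding far_def by simp arith
  qed
  \<comment> \<open>The two local potentials of \<open>P\<close>: a constant and the indicator of a
    half space. Away from the hole every window sees \<open>P\<close> as one of these two
    gradients.\<close>
  let ?y0 = "gradient k l enc (\<lambda>_. False)" and ?y1 = "gradient k l enc (\<lambda>v. v $ l > 0)"
  have y0: "?y0 v = enc (False, False)" for v by (simp add: gradient_def)
  have y1: "?y1 v = enc (False, v $ l = 0)" for v
  proof -
    have "((v $ l > 0) \<noteq> ((v + axis l 1) $ l > 0)) = (v $ l = 0)" by (auto simp: axis_def)
    moreover have "(v + axis k 1) $ l = v $ l" using kl by (simp add: axis_def)
    ultimately show ?thesis by (simp only: gradient_def simp_thms)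
  qed
  have lv: "locally_valid ?A ?Y W (?D + N) (restrict P (?D + N))"
    unfolding locally_valid_iff
  proof (intro conjI allI impI)
    show "restrict P (?D + N) \<in> ?D + N \<rightarrow>\<^sub>E ?A" by (auto simp: P_def)
    fix g assume g: "(+) g ` W \<subseteq> ?D + N"
    have "\<exists>y\<in>?Y. \<forall>w\<in>W. y (g + w) = P (g + w)"
    proof (cases "W = {}")
      case True then show ?thesis using gradient_in_flat_shift[where dec=dec, OF dec] by blast
    next
      case False
      then obtain w0 where w0: "w0 \<in> W" by blast
      have far0: "g + w0 \<in> far L" using g DN w0 by blast
      have bd: "\<bar>(g + w) $ i - (g + w0) $ i\<bar> \<le> 2 * r" if "w \<in> W" for w i
        using r(2)[of w i] r(2)[of w0 i] that w0 by simp
      consider "\<bar>(g + w0) $ l\<bar> \<ge> L \<or> (g + w0) $ k \<le> - L" | "(g + w0) $ k \<ge> L"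
        using far0 by (auto simp: far_def abs_if split: if_splits)
      then show ?thesis
      proof cases
        case 1
        have "?y0 (g + w) = P (g + w)" if "w \<in> W" for w
        proof -
          have "\<not> ((g + w) $ l = 0 \<and> (g + w) $ k > 0)"
            using bd[OF that, of l] bd[OF that, of k] 1 unfolding L_def by arith
          then have "((g + w) $ l = 0 \<and> (g + w) $ k > 0) = False" by blast
          then show ?thesis unfolding y0 P_def by (rule arg_cong2[where f="\<lambda>a b. enc (a, b)", OF refl, OF sym])
        qed
        then show ?thesis using gradient_in_flat_shift[where dec=dec, OF dec] by blast
      next
        case 2
        have "?y1 (g + w) = P (g + w)" if "w \<in> W" for w
        proof -
          have "(g + w) $ k > 0" using bd[OF that, of k] 2 unfolding L_def by arith
          then show ?thesis unfolding y1 P_def by simp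
        qed
        then show ?thesis using gradient_in_flat_shift[where dec=dec, OF dec] by blast
      qed
    qed
    then obtain y where y: "y \<in> ?Y" "\<And>w. w \<in> W \<Longrightarrow> y (g + w) = P (g + w)" by blast
    then have "restrict (\<lambda>w. restrict P (?D + N) (g + w)) W = restrict (\<lambda>w. y (g + w)) W"
      using g by (intro restrict_ext) auto
    then show "restrict (\<lambda>w. restrict P (?D + N) (g + w)) W \<notin> forbidden ?A ?Y W"
      using not_forbidden[OF y(1)] by metis
  qed
  have DsubDN: "?D \<subseteq> ?D + N"
  proof
    fix d assume "d \<in> ?D" then show "d \<in> ?D + N" using set_plus_intro[of d ?D 0 N] N0 by simp
  qed
  have "axis k (L + r) \<in> ?D" using r(1) kl by (simp add: far_def axis_def L_def)
  then have "?D \<noteq> {}" by blast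
  then have "globally_valid ?Y ?D (restrict (restrict P (?D + N)) ?D)" by (rule ext[OF _ lv])
  moreover have "restrict (restrict P (?D + N)) ?D = restrict P ?D"
    using DsubDN by (auto simp: Int_absorb1)
  ultimately have "globally_valid ?Y ?D (restrict P ?D)" by simp
  then obtain y where y: "y \<in> ?Y" "restrict P ?D = restrict y ?D" by (auto simp: globally_valid_def)
  then obtain x where x: "y = gradient k l enc x"
    using flat_shift_eq_gradients[where dec=dec, OF kl dec] by auto
  have grad: "x v = x (v + axis k 1)" "(x v \<noteq> x (v + axis l 1)) = (v $ l = 0 \<and> v $ k > 0)" if "v \<in> ?D" for v
  proof -
    have "y v = P v" using y(2) that by (metis restrict_apply')
    then have "dec (y v) = dec (P v)" by simp
    then show "x v = x (v + axis k 1)" "(x v \<noteq> x (v + axis l 1)) = (v $ l = 0 \<and> v $ k > 0)"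
      by (auto simp: x gradient_def P_def dec)
  qed
  define X where "X = (\<lambda>s t. x (axis k s + axis l t))"
  define K where "K = L + r"
  have K: "K \<ge> 1" using r(1) by (simp add: K_def L_def)
  have Xk: "X (s + 1) t = X s t" and Xl: "(X s (t + 1) = X s t) = (t \<noteq> 0 \<or> s \<le> 0)"
    if "\<bar>s\<bar> \<ge> K \<or> \<bar>t\<bar> \<ge> K" for s t
  proof -
    let ?v = "axis k s + axis l t :: int ^ 'n"
    have v: "?v \<in> ?D" using that kl by (simp add: far_def axis_def K_def)
    have e: "axis k (s + 1) + axis l t = ?v + axis k 1" "axis k s + axis l (t + 1) = ?v + axis l 1"
      by (simp_all add: vec_eq_iff axis_def)
    have "?v $ k = s" "?v $ l = t" using kl by (simp_all add: axis_def)
    then show "X (s + 1) t = X s t" "(X s (t + 1) = X s t) = (t \<noteq> 0 \<or> s \<le> 0)"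
      using grad[OF v] by (auto simp: X_def e)
  qed
  \<comment> \<open>A walk around the hole that starts and ends on the side \<open>s = K\<close>, at
    heights 1 and 0: all edges on the way are trivial, while the edge that closes the loop is
    not.\<close>
  have "X K K = X K 1"
    by (rule constant_on_int_interval[of 1 K "X K"]) (use K Xl[of K] in auto)
  moreover have "X K K = X (- K) K"
    by (rule constant_on_int_interval[of "- K" K "\<lambda>s. X s K"]) (use K Xk[of _ K] in auto)
  moreover have "X (- K) K = X (- K) (- K)"
    by (rule constant_on_int_interval[of "- K" K "X (- K)"]) (use K Xl[of "- K"] in auto)
  moreover have "X K (- K) = X (- K) (- K)"
    by (rule constant_on_int_interval[of "- K" K "\<lambda>s. X s (- K)"]) (use K Xk[of _ "- K"] in auto)
  moreover have "X K 0 = X K (- K)"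
    by (rule constant_on_int_interval[of "- K" 0 "X K"]) (use K Xl[of K] in auto)
  moreover have "X K 1 \<noteq> X K 0" using Xl[of K 0] K by auto
  ultimately show False by simp
qed

section \<open>Coloured markers\<close>

definition cube :: "int \<Rightarrow> (int ^ 'n) set" where
  "cube r = {v. \<forall>i. \<bar>v $ i\<bar> \<le> r}"

lemma finite_cube: "finite (cube r :: (int ^ 'n::finite) set)"
proof -
  have "vec_nth ` (cube r :: (int ^ 'n) set) \<subseteq> UNIV \<rightarrow>\<^sub>E {- r..r}"
    by (auto simp: cube_def abs_le_iff minus_le_iff)
  then have "finite (vec_nth ` (cube r :: (int ^ 'n) set))"
    by (rule finite_subset) (intro finite_PiE; simp)
  then show ?thesis by (rule finite_imageD) (simp add: inj_on_def vec_nth_inject)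
qed

lemma zero_in_cube [simp]: "0 \<le> r \<Longrightarrow> 0 \<in> cube r"
  by (simp add: cube_def)

lemma uminus_in_cube_iff [simp]: "- v \<in> cube r \<longleftrightarrow> v \<in> cube r"
  by (simp add: cube_def)

lemma cube_minus_commute: "u - v \<in> cube r \<longleftrightarrow> v - u \<in> cube r"
  by (simp add: cube_def abs_minus_commute)

lemma cube_add: "u \<in> cube r \<Longrightarrow> v \<in> cube s \<Longrightarrow> r + s \<le> t \<Longrightarrow> u + v \<in> cube t"
proof -
  assume *: "u \<in> cube r" "v \<in> cube s" "r + s \<le> t"
  have "\<bar>u $ i + v $ i\<bar> \<le> t" for i
  proof -
    have "\<bar>u $ i\<bar> \<le> r" "\<bar>v $ i\<bar> \<le> s" using * by (auto simp: cube_def)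
    then show ?thesis using *(3) by linarith
  qed
  then show ?thesis by (simp add: cube_def)
qed

lemma cube_diff: "u \<in> cube r \<Longrightarrow> v \<in> cube s \<Longrightarrow> r + s \<le> t \<Longrightarrow> u - v \<in> cube t"
  using cube_add[of u r "- v" s t] by simp

lemma cube_mono: "u \<in> cube r \<Longrightarrow> r \<le> t \<Longrightarrow> u \<in> cube t"
  unfolding cube_def mem_Collect_eq by (meson order_trans)

text \<open>The factor 4 leaves room for balls of radius almost \<open>2 * \<rho>\<close> around the
  sites of one colour.\<close>

definition separated :: "int \<Rightarrow> (int ^ 'n \<Rightarrow> nat) \<Rightarrow> bool" where
  "separated \<rho> c \<longleftrightarrow> (\<forall>u v. u \<noteq> v \<longrightarrow> c u \<noteq> 0 \<longrightarrow> c v \<noteq> 0 \<longrightarrow>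
     u - v \<notin> cube \<rho> \<and> (c u = c v \<longrightarrow> u - v \<notin> cube (4 * \<rho>)))"

text \<open>The condition as seen from the origin, in the shape that \<open>sft_localI\<close> asks
  for. Its second half expresses maximality of the marked set as a covering by balls.\<close>

definition marker_at :: "int \<Rightarrow> (int ^ 'n \<Rightarrow> nat) \<Rightarrow> bool" where
  "marker_at \<rho> c \<longleftrightarrow>
     (\<forall>m\<in>cube (4 * \<rho>). m \<noteq> 0 \<longrightarrow> c 0 \<noteq> 0 \<longrightarrow> c m \<noteq> 0 \<longrightarrow> m \<notin> cube \<rho> \<and> c m \<noteq> c 0) \<and>
     (\<exists>m\<in>cube \<rho>. c m \<noteq> 0)"

text \<open>Maximal \<open>\<rho>\<close>-separated sets of sites together with a colouring in which sites of equal
  colour are at distance more than \<open>4 * \<rho>\<close>; the symbol \<open>0\<close> stands for unmarked sites.\<close>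

definition marker_shift :: "int \<Rightarrow> nat \<Rightarrow> (int ^ 'n \<Rightarrow> nat) set" where
  "marker_shift \<rho> K = {c \<in> configs {0..K}. \<forall>g. marker_at \<rho> (\<lambda>h. c (g + h))}"

lemma marker_at_cong:
  assumes \<rho>: "0 \<le> \<rho>" and eq: "\<forall>w\<in>cube (4 * \<rho>). c w = c' w"
  shows "marker_at \<rho> c \<longleftrightarrow> marker_at \<rho> c'"
proof -
  have "c 0 = c' 0" using eq \<rho> by simp
  moreover have "w \<in> cube (4 * \<rho>)" if "w \<in> cube \<rho>" for w :: "int ^ 'a"
    by (rule cube_mono[OF that]) (use \<rho> in simp)
  ultimately show ?thesis using eq unfolding marker_at_def by auto
qed

lemma marker_shift_iff:
  assumes \<rho>: "0 \<le> \<rho>"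
  shows "c \<in> marker_shift \<rho> K \<longleftrightarrow>
    c \<in> configs {0..K} \<and> separated \<rho> c \<and> (\<forall>v. \<exists>m\<in>cube \<rho>. c (v + m) \<noteq> 0)"
proof -
  have "separated \<rho> c \<longleftrightarrow> (\<forall>g. \<forall>m\<in>cube (4 * \<rho>). m \<noteq> 0 \<longrightarrow> c g \<noteq> 0 \<longrightarrow> c (g + m) \<noteq> 0 \<longrightarrow>
      m \<notin> cube \<rho> \<and> c (g + m) \<noteq> c g)" (is "_ \<longleftrightarrow> ?R")
  proof
    assume sep: "separated \<rho> c"
    show ?R
    proof (intro allI ballI impI)
      fix g m assume "m \<in> cube (4 * \<rho>)" "m \<noteq> 0" "c g \<noteq> 0" "c (g + m) \<noteq> 0"
      then show "m \<notin> cube \<rho> \<and> c (g + m) \<noteq> c g"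
        using sep[unfolded separated_def, rule_format, of "g + m" g] by auto
    qed
  next
    assume R: ?R
    show "separated \<rho> c"
      unfolding separated_def
    proof (intro allI impI)
      fix u v assume uv: "u \<noteq> v" "c u \<noteq> 0" "c v \<noteq> 0"
      have *: "u - v \<notin> cube \<rho> \<and> c u \<noteq> c v" if "u - v \<in> cube (4 * \<rho>)"
        using R[rule_format, OF that, of v] uv by simp
      have "u - v \<notin> cube \<rho>"
      proof
        assume "u - v \<in> cube \<rho>"
        moreover from this have "u - v \<in> cube (4 * \<rho>)" by (rule cube_mono) (use \<rho> in simp)
        ultimately show False using * by blast
      qed
      then show "u - v \<notin> cube \<rho> \<and> (c u = c v \<longrightarrow> u - v \<notin> cube (4 * \<rho>))" using * by blast
    qed
  qed
  then show ?thesis unfolding marker_shift_def marker_at_def by auto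
qed

text \<open>The bound does not depend on \<open>\<rho>\<close>: cover \<open>cube (4 * \<rho>)\<close> by cubes of side \<open>\<rho> + 1\<close>.\<close>

lemma separated_packing:
  fixes c :: "int ^ 'n::finite \<Rightarrow> nat"
  assumes \<rho>: "0 \<le> \<rho>" and sep: "separated \<rho> c"
  shows "card {u \<in> cube (4 * \<rho>). c (v + u) \<noteq> 0} \<le> 8 ^ CARD('n)"
proof -
  let ?P = "{u \<in> cube (4 * \<rho>). c (v + u) \<noteq> 0}"
  \<comment> \<open>The index of the box containing \<open>u\<close>. Along each axis
    \<open>u $ i + 4 * \<rho>\<close> lies between 0 and \<open>8 * \<rho>\<close>, which gives
    eight boxes, and two sites in one box are at most \<open>\<rho>\<close> apart.\<close>
  let ?f = "\<lambda>u::int ^ 'n. \<lambda>i. (u $ i + 4 * \<rho>) div (\<rho> + 1)"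
  have "?f ` ?P \<subseteq> UNIV \<rightarrow>\<^sub>E {0..7}"
  proof (intro image_subsetI PiE_I)
    fix u :: "int ^ 'n" and i assume "u \<in> ?P"
    then have "\<bar>u $ i\<bar> \<le> 4 * \<rho>" by (simp add: cube_def)
    then have "0 \<le> u $ i + 4 * \<rho>" "u $ i + 4 * \<rho> < 8 * (\<rho> + 1)"
      using \<rho> by (simp_all add: abs_le_iff distrib_left)
    moreover have "(u $ i + 4 * \<rho>) div (\<rho> + 1) * (\<rho> + 1) \<le> u $ i + 4 * \<rho>"
      using \<rho> by (simp add: minus_mod_eq_div_mult[symmetric])
    ultimately have "(u $ i + 4 * \<rho>) div (\<rho> + 1) * (\<rho> + 1) < 8 * (\<rho> + 1)" by linarith
    then have "(u $ i + 4 * \<rho>) div (\<rho> + 1) < 8" 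
      by (rule mult_right_less_imp_less) (use \<rho> in simp)
    moreover have "0 \<le> (u $ i + 4 * \<rho>) div (\<rho> + 1)"
      using \<rho> \<open>0 \<le> u $ i + 4 * \<rho>\<close> by (simp add: pos_imp_zdiv_nonneg_iff)
    ultimately show "(u $ i + 4 * \<rho>) div (\<rho> + 1) \<in> {0..7}" by simp
  qed simp
  moreover have "inj_on ?f ?P"
  proof (rule inj_onI, rule ccontr)
    fix u u' assume u: "u \<in> ?P" and u': "u' \<in> ?P" and eq: "?f u = ?f u'" and ne: "u \<noteq> u'"
    have "\<bar>u $ i - u' $ i\<bar> \<le> \<rho>" for i
    proof -
      let ?a = "u $ i + 4 * \<rho>" and ?b = "u' $ i + 4 * \<rho>" and ?n = "\<rho> + 1"
      have "?a = ?n * (?a div ?n) + ?a mod ?n" "?b = ?n * (?b div ?n) + ?b mod ?n" by simp_all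
      moreover have "?a div ?n = ?b div ?n" using eq by (rule fun_cong)
      moreover have "0 \<le> ?a mod ?n" "?a mod ?n < ?n" "0 \<le> ?b mod ?n" "?b mod ?n < ?n"
        using \<rho> pos_mod_sign[of ?n] pos_mod_bound[of ?n] by simp_all
      ultimately have "?a - ?b = ?a mod ?n - ?b mod ?n" by (metis add_diff_cancel_left)
      then have "u $ i - u' $ i = ?a mod ?n - ?b mod ?n" by simp
      then show ?thesis
        using \<open>0 \<le> ?a mod ?n\<close> \<open>?a mod ?n < ?n\<close> \<open>0 \<le> ?b mod ?n\<close> \<open>?b mod ?n < ?n\<close> by linarith
    qed
    then have "(v + u) - (v + u') \<in> cube \<rho>" by (simp add: cube_def)
    then show False using sep[unfolded separated_def, rule_format, of "v + u" "v + u'"] u u' ne by simp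
  qed
  ultimately have "card ?P \<le> card (UNIV \<rightarrow>\<^sub>E {0..7} :: ('n \<Rightarrow> int) set)"
    by (intro card_inj_on_le[of ?f]) (auto intro!: finite_PiE)
  also have "\<dots> = 8 ^ CARD('n)" by (subst card_PiE) simp_all
  finally show ?thesis .
qed

text \<open>Greedy colouring: at most \<open>8 ^ CARD('n)\<close> marks lie nearby, so one of the
  colours from 1 to \<open>8 ^ CARD('n) + 1\<close> is absent there.\<close>

lemma free_colour:
  fixes c :: "int ^ 'n::finite \<Rightarrow> nat" and v :: "int ^ 'n"
  assumes \<rho>: "0 \<le> \<rho>" and sep: "separated \<rho> c"
  defines "n \<equiv> (LEAST n. n \<noteq> 0 \<and> (\<forall>m\<in>cube (4 * \<rho>). c (v + m) \<noteq> n))"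
  shows "n \<noteq> 0" "n \<le> 8 ^ CARD('n) + 1" "\<And>m. m \<in> cube (4 * \<rho>) \<Longrightarrow> c (v + m) \<noteq> n"
proof -
  let ?P = "{u \<in> cube (4 * \<rho>). c (v + u) \<noteq> 0}" and ?K = "8 ^ CARD('n) + 1 :: nat"
  have fin: "finite ?P" by (rule finite_subset[OF _ finite_cube]) blast
  have "card ((\<lambda>u. c (v + u)) ` ?P) \<le> 8 ^ CARD('n)"
    using card_image_le[OF fin] separated_packing[OF \<rho> sep] order_trans by blast
  then have "\<not> {1..?K} \<subseteq> (\<lambda>u. c (v + u)) ` ?P"
    using card_mono[of "(\<lambda>u. c (v + u)) ` ?P" "{1..?K}"] fin by auto
  then obtain n' where n': "n' \<in> {1..?K}" "n' \<notin> (\<lambda>u. c (v + u)) ` ?P" by blast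
  have ok: "n' \<noteq> 0 \<and> (\<forall>m\<in>cube (4 * \<rho>). c (v + m) \<noteq> n')"
  proof (intro conjI ballI notI)
    fix m assume m: "m \<in> cube (4 * \<rho>)" "c (v + m) = n'"
    then show False using n' by (auto simp: image_iff)
  qed (use n'(1) in auto)
  then have "n \<noteq> 0 \<and> (\<forall>m\<in>cube (4 * \<rho>). c (v + m) \<noteq> n)" unfolding n_def by (rule LeastI)
  then show "n \<noteq> 0" "\<And>m. m \<in> cube (4 * \<rho>) \<Longrightarrow> c (v + m) \<noteq> n" by blast+
  have "n \<le> n'" unfolding n_def using ok by (rule Least_le)
  then show "n \<le> ?K" using n'(1) by simp
qed

text \<open>For \<open>p = (a, u)\<close>, the step treats the sites at offset \<open>u\<close> from the sites of colour \<open>a\<close> of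
  the guide \<open>c\<close>. They are so far apart that they can be marked simultaneously.\<close>

definition fill_step ::
  "int \<Rightarrow> nat \<times> (int ^ 'n) \<Rightarrow> (int ^ 'n \<Rightarrow> nat) \<Rightarrow> (int ^ 'n \<Rightarrow> nat) \<Rightarrow> int ^ 'n \<Rightarrow> nat" where
  "fill_step \<rho> p c s v =
     (if c (v + - snd p) = fst p \<and> (\<forall>m\<in>cube \<rho>. s (v + m) = 0)
      then LEAST n. n \<noteq> 0 \<and> (\<forall>m\<in>cube (4 * \<rho>). s (v + m) \<noteq> n) else s v)"

text \<open>A marked site lies in its own ball and thus blocks the step.\<close>

lemma fill_step_mono:
  assumes "0 \<le> \<rho>" "s v \<noteq> 0"
  shows "fill_step \<rho> p c s v = s v"
  using assms zero_in_cube[OF assms(1)] unfolding fill_step_def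
  by (metis add.right_neutral)

text \<open>Two new marks are translates of two sites of one colour of \<open>c\<close>, hence far
  apart. A new mark is placed only in a gap, which keeps it away from the old ones, and its colour
  is absent nearby.\<close>

lemma fill_step_separated:
  fixes s :: "int ^ 'n::finite \<Rightarrow> nat"
  assumes \<rho>: "0 \<le> \<rho>" and sep: "separated \<rho> s" and c: "separated \<rho> c" and a: "fst p \<noteq> 0"
    and s: "s \<in> configs {0..8 ^ CARD('n) + 1}"
  shows "separated \<rho> (fill_step \<rho> p c s)"
    "fill_step \<rho> p c s \<in> configs {0..8 ^ CARD('n) + 1}"
proof -
  let ?s = "fill_step \<rho> p c s"
  let ?new = "\<lambda>v. c (v + - snd p) = fst p \<and> (\<forall>m\<in>cube \<rho>. s (v + m) = 0)"
  have old: "?s v = s v" if "\<not> ?new v" for v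
    using that by (auto simp: fill_step_def)
  have new: "?s v = (LEAST n. n \<noteq> 0 \<and> (\<forall>m\<in>cube (4 * \<rho>). s (v + m) \<noteq> n))" if "?new v" for v
    using that by (simp add: fill_step_def)
  show "?s \<in> configs {0..8 ^ CARD('n) + 1}"
  proof -
    have "?s v \<le> 8 ^ CARD('n) + 1" for v
    proof (cases "?new v")
      case True then show ?thesis using free_colour(2)[OF \<rho> sep] by (simp add: new)
    next
      case False
      have "s v \<in> {0..8 ^ CARD('n) + 1}" using s by blast
      then show ?thesis using old[OF False] by simp
    qed
    then show ?thesis by (simp add: PiE_iff)
  qed
  have new_old: "v - u \<notin> cube \<rho> \<and> (?s v = ?s u \<longrightarrow> v - u \<notin> cube (4 * \<rho>))"
    if u: "?new u" and v: "\<not> ?new v" "?s v \<noteq> 0" for u v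
  proof
    have "s v \<noteq> 0" using v old by simp
    then have "s (u + (v - u)) \<noteq> 0" by simp
    then show "v - u \<notin> cube \<rho>" using bspec[OF conjunct2[OF u], of "v - u"] by metis
    have "?s u \<noteq> s (u + (v - u))" if "v - u \<in> cube (4 * \<rho>)"
      using free_colour(3)[OF \<rho> sep that, of u] new[OF u] by simp
    then show "?s v = ?s u \<longrightarrow> v - u \<notin> cube (4 * \<rho>)" using old[OF v(1)] by auto
  qed
  show "separated \<rho> ?s"
    unfolding separated_def
  proof (intro allI impI)
    fix u v assume uv: "u \<noteq> v" "?s u \<noteq> 0" "?s v \<noteq> 0"
    show "u - v \<notin> cube \<rho> \<and> (?s u = ?s v \<longrightarrow> u - v \<notin> cube (4 * \<rho>))"
    proof (cases "?new u"; cases "?new v")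
      assume n: "?new u" "?new v"
      have "(u + - snd p) - (v + - snd p) \<notin> cube (4 * \<rho>)"
        using c[unfolded separated_def, rule_format, of "u + - snd p" "v + - snd p"] n uv(1) a by simp
      then have "u - v \<notin> cube (4 * \<rho>)" by simp
      moreover from this have "u - v \<notin> cube \<rho>" using cube_mono[of "u - v" \<rho> "4 * \<rho>"] \<rho> by auto
      ultimately show ?thesis by blast
    next
      assume n: "?new u" "\<not> ?new v"
      then show ?thesis using new_old[OF n uv(3)] cube_minus_commute[of u v] by metis
    next
      assume n: "\<not> ?new u" "?new v"
      then show ?thesis using new_old[OF n(2,1) uv(2)] by blast
    next
      assume n: "\<not> ?new u" "\<not> ?new v"
      then show ?thesis using sep[unfolded separated_def, rule_format, OF uv(1)] uv
        unfolding old[OF n(1)] old[OF n(2)] by blast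
    qed
  qed
qed

lemma local_map_fill_step:
  fixes X S :: "(int ^ 'n::finite \<Rightarrow> 'b) \<Rightarrow> int ^ 'n \<Rightarrow> nat"
  assumes \<rho>: "0 \<le> \<rho>" and X: "local_map X" and S: "local_map S"
  shows "local_map (\<lambda>t. fill_step \<rho> p (X t) (S t))"
proof -
  have "local_map (\<lambda>q. fill_step \<rho> p (\<lambda>v. fst (q v)) (\<lambda>v. snd (q v)))"
  proof (rule local_mapI)
    show "finite (insert (- snd p) (cube (4 * \<rho>)))" using finite_cube by simp
    fix q q' :: "int ^ 'n \<Rightarrow> nat \<times> nat" and g g'
    assume eq: "\<And>m. m \<in> insert (- snd p) (cube (4 * \<rho>)) \<Longrightarrow> q (g + m) = q' (g' + m)"
    have c: "q (g + - snd p) = q' (g' + - snd p)" using eq by blast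
    have s: "q (g + m) = q' (g' + m)" if "m \<in> cube (4 * \<rho>)" for m using eq that by blast
    have s0: "q g = q' g'" using s[of 0] \<rho> by simp
    have s1: "q (g + m) = q' (g' + m)" if "m \<in> cube \<rho>" for m
      using s cube_mono[OF that, of "4 * \<rho>"] \<rho> by simp
    show "fill_step \<rho> p (\<lambda>v. fst (q v)) (\<lambda>v. snd (q v)) g
        = fill_step \<rho> p (\<lambda>v. fst (q' v)) (\<lambda>v. snd (q' v)) g'"
      unfolding fill_step_def c s0 using s s1 by (simp cong: ball_cong)
  qed
  from local_map_compose[OF this local_map_pair[OF X S]] show ?thesis by simp
qed

section \<open>Filling all gaps of a marker configuration\<close>

definition fill_all ::
  "int \<Rightarrow> (nat \<times> (int ^ 'n)) list \<Rightarrow> (int ^ 'n \<Rightarrow> nat) \<Rightarrow> (int ^ 'n \<Rightarrow> nat) \<Rightarrow> int ^ 'n \<Rightarrow> nat" where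
  "fill_all \<rho> ps c s = fold (\<lambda>p s. fill_step \<rho> p c s) ps s"

lemma fill_all_simps [simp]:
  "fill_all \<rho> [] c s = s"
  "fill_all \<rho> (p # ps) c s = fill_all \<rho> ps c (fill_step \<rho> p c s)"
  by (simp_all add: fill_all_def)

lemma fill_all_mono: "0 \<le> \<rho> \<Longrightarrow> s v \<noteq> 0 \<Longrightarrow> fill_all \<rho> ps c s v = s v"
  by (induction ps arbitrary: s) (simp_all add: fill_step_mono)

lemma fill_all_separated:
  fixes s :: "int ^ 'n::finite \<Rightarrow> nat"
  assumes "0 \<le> \<rho>" "separated \<rho> s" "separated \<rho> c" "\<forall>p\<in>set ps. fst p \<noteq> 0"
    and "s \<in> configs {0..8 ^ CARD('n) + 1}"
  shows "separated \<rho> (fill_all \<rho> ps c s) \<and>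
    fill_all \<rho> ps c s \<in> configs {0..8 ^ CARD('n) + 1}"
  using assms
proof (induction ps arbitrary: s)
  case (Cons p ps)
  have "separated \<rho> (fill_step \<rho> p c s)" "fill_step \<rho> p c s \<in> configs {0..8 ^ CARD('n) + 1}"
    using Cons.prems by (intro fill_step_separated; simp)+
  then show ?case using Cons by simp
qed simp

text \<open>When \<open>p\<close> has its turn, either a mark is already near \<open>v\<close> or
  one is put at \<open>v\<close>; later steps remove nothing.\<close>

lemma fill_all_covers:
  fixes s :: "int ^ 'n::finite \<Rightarrow> nat"
  assumes \<rho>: "0 \<le> \<rho>" and c: "separated \<rho> c" "\<forall>p\<in>set ps. fst p \<noteq> 0"
    and s: "separated \<rho> s" "s \<in> configs {0..8 ^ CARD('n) + 1}"
    and p: "p \<in> set ps" "c (v + - snd p) = fst p"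
  shows "\<exists>m\<in>cube \<rho>. fill_all \<rho> ps c s (v + m) \<noteq> 0"
  using c(2) s p(1)
proof (induction ps arbitrary: s)
  case (Cons p' ps)
  show ?case
  proof (cases "p' = p")
    case True
    have "\<exists>m\<in>cube \<rho>. fill_step \<rho> p c s (v + m) \<noteq> 0"
    proof (cases "\<forall>m\<in>cube \<rho>. s (v + m) = 0")
      case True
      then have "fill_step \<rho> p c s (v + 0) \<noteq> 0"
        using p(2) free_colour(1)[OF \<rho> Cons.prems(2)] by (simp add: fill_step_def)
      then show ?thesis using zero_in_cube[OF \<rho>] by blast
    next
      case False
      then show ?thesis using fill_step_mono[OF \<rho>] by metis
    qed
    then show ?thesis using fill_all_mono[OF \<rho>] True by (metis fill_all_simps(2))
  next
    case False
    have "separated \<rho> (fill_step \<rho> p' c s)" "fill_step \<rho> p' c s \<in> configs {0..8 ^ CARD('n) + 1}"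
      using Cons.prems \<rho> c(1) by (intro fill_step_separated; simp)+
    then show ?thesis using Cons False by simp
  qed
qed simp

text \<open>Without gaps no step acts; this secures the two ends of the contraction.\<close>

lemma fill_all_complete:
  assumes "\<forall>v. \<exists>m\<in>cube \<rho>. s (v + m) \<noteq> 0"
  shows "fill_all \<rho> ps c s = s"
proof (induction ps)
  case (Cons p ps)
  have "\<not> (\<forall>m\<in>cube \<rho>. s (v + m) = 0)" for v using spec[OF assms, of v] by auto
  then have "fill_step \<rho> p c s v = s v" for v unfolding fill_step_def by (meson if_not_P)
  then have "fill_step \<rho> p c s = s" by (rule ext)
  then show ?case using Cons by simp
qed simp

lemma local_map_fill_all:
  fixes X S :: "(int ^ 'n::finite \<Rightarrow> 'b) \<Rightarrow> int ^ 'n \<Rightarrow> nat"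
  assumes "0 \<le> \<rho>" "local_map X" "local_map S"
  shows "local_map (\<lambda>t. fill_all \<rho> ps (X t) (S t))"
  using assms(3)
proof (induction ps arbitrary: S)
  case (Cons p ps)
  show ?case using Cons.IH[OF local_map_fill_step[OF assms(1,2) Cons.prems]] by simp
qed simp

lemma marker_shift_contraction:
  assumes \<rho>: "0 \<le> \<rho>"
  defines "C \<equiv> marker_shift \<rho> (8 ^ CARD('n) + 1) :: (int ^ 'n::finite \<Rightarrow> nat) set"
  shows "\<exists>H. local_map H \<and>
    (\<forall>x\<in>C. \<forall>y\<in>C. (\<forall>i\<in>configs {0, 1}. H (\<lambda>g. (i g, x g, y g)) \<in> C) \<and>
      H (\<lambda>g. (0 :: nat, x g, y g)) = x \<and> H (\<lambda>g. (1, x g, y g)) = y)"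
proof -
  let ?K = "8 ^ CARD('n) + 1 :: nat"
  \<comment> \<open>All pairs of a colour and an offset, in some fixed order; that the order is the
    same everywhere makes the filling equivariant.\<close>
  obtain ps where ps: "set ps = {1..?K} \<times> (cube \<rho> :: (int ^ 'n) set)"
    using finite_list[of "{1..?K} \<times> (cube \<rho> :: (int ^ 'n) set)"] finite_cube by auto
  \<comment> \<open>Marks survive only where \<open>i\<close> is constant on the surrounding cube. A
    surviving mark of \<open>x\<close> and one of \<open>y\<close> are then more than
    \<open>4 * \<rho>\<close> apart, so they cannot conflict, whatever their colours.\<close>
  define S where "S = (\<lambda>(t :: int ^ 'n \<Rightarrow> nat \<times> nat \<times> nat) v.
    if \<forall>m\<in>cube (4 * \<rho>). fst (t (v + m)) = 0 then fst (snd (t v))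
    else if \<forall>m\<in>cube (4 * \<rho>). fst (t (v + m)) \<noteq> 0 then snd (snd (t v)) else 0)"
  define H where "H = (\<lambda>t. fill_all \<rho> ps (\<lambda>v. fst (snd (t v))) (S t))"
  have 0: "(0 :: int ^ 'n) \<in> cube (4 * \<rho>)" using \<rho> by simp
  have "local_map S"
  proof (rule local_mapI)
    show "finite (cube (4 * \<rho>) :: (int ^ 'n) set)" by (rule finite_cube)
    fix t t' :: "int ^ 'n \<Rightarrow> nat \<times> nat \<times> nat" and g g'
    assume eq: "\<And>m. m \<in> cube (4 * \<rho>) \<Longrightarrow> t (g + m) = t' (g' + m)"
    have "t g = t' g'" using eq[OF 0] by simp
    moreover have "(\<forall>m\<in>cube (4 * \<rho>). fst (t (g + m)) = 0) = (\<forall>m\<in>cube (4 * \<rho>). fst (t' (g' + m)) = 0)"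
      "(\<forall>m\<in>cube (4 * \<rho>). fst (t (g + m)) \<noteq> 0) = (\<forall>m\<in>cube (4 * \<rho>). fst (t' (g' + m)) \<noteq> 0)"
      by (intro ball_cong refl; simp add: eq)+
    ultimately show "S t g = S t' g'" by (simp only: S_def)
  qed
  then have "local_map H"
    unfolding H_def by (intro local_map_fill_all[OF \<rho> local_map_pointwise])
  moreover have "H (\<lambda>g. (i g, x g, y g)) \<in> C" if x: "x \<in> C" and y: "y \<in> C" for i x y
  proof -
    let ?t = "\<lambda>g. (i g, x g, y g)"
    have xK: "x \<in> configs {0..?K}" "separated \<rho> x" "\<And>v. \<exists>m\<in>cube \<rho>. x (v + m) \<noteq> 0"
      using x unfolding C_def marker_shift_iff[OF \<rho>] by blast+
    have yK: "y \<in> configs {0..?K}" "separated \<rho> y"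
      using y unfolding C_def marker_shift_iff[OF \<rho>] by blast+
    have SK: "S ?t \<in> configs {0..?K}"
    proof -
      have "x v \<le> ?K" "y v \<le> ?K" for v using xK(1) yK(1) by (simp_all add: PiE_iff)
      then have "S ?t v \<in> {0..?K}" for v by (simp add: S_def)
      then show ?thesis by (simp add: PiE_iff)
    qed
    have mixed: "u - v \<notin> cube (4 * \<rho>)"
      if "\<forall>m\<in>cube (4 * \<rho>). i (u + m) = 0" "\<forall>m\<in>cube (4 * \<rho>). i (v + m) \<noteq> 0" for u v
    proof
      assume "u - v \<in> cube (4 * \<rho>)"
      then have "i (v + (u - v)) \<noteq> 0" using that(2) by blast
      then show False using that(1) 0 by force
    qed
    have sepS: "separated \<rho> (S ?t)"
      unfolding separated_def
    proof (intro allI impI)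
      fix u v assume uv: "u \<noteq> v" "S ?t u \<noteq> 0" "S ?t v \<noteq> 0"
      let ?X = "\<lambda>v. \<forall>m\<in>cube (4 * \<rho>). i (v + m) = 0" and ?Y = "\<lambda>v. \<forall>m\<in>cube (4 * \<rho>). i (v + m) \<noteq> 0"
      have cs: "?X v \<and> S ?t v = x v \<or> ?Y v \<and> S ?t v = y v" if "S ?t v \<noteq> 0" for v
        using that by (auto simp: S_def split: if_splits)
      have far: "u - v \<notin> cube \<rho>" if "u - v \<notin> cube (4 * \<rho>)"
        using that cube_mono[of "u - v" \<rho> "4 * \<rho>"] \<rho> by auto
      consider "S ?t u = x u" "S ?t v = x v" | "S ?t u = y u" "S ?t v = y v"
        | "?X u" "?Y v" | "?X v" "?Y u"
        using cs[OF uv(2)] cs[OF uv(3)] by blast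
      then show "u - v \<notin> cube \<rho> \<and> (S ?t u = S ?t v \<longrightarrow> u - v \<notin> cube (4 * \<rho>))"
      proof cases
        case 1 then show ?thesis
          using xK(2)[unfolded separated_def, rule_format, OF uv(1)] uv(2,3) by metis
      next
        case 2 then show ?thesis
          using yK(2)[unfolded separated_def, rule_format, OF uv(1)] uv(2,3) by metis
      next
        case 3 then show ?thesis using mixed far by blast
      next
        case 4
        then have "u - v \<notin> cube (4 * \<rho>)" using mixed cube_minus_commute by blast
        then show ?thesis using far by blast
      qed
    qed
    have a: "\<forall>p\<in>set ps. fst p \<noteq> 0" using ps by auto
    have "\<exists>m\<in>cube \<rho>. H ?t (v + m) \<noteq> 0" for v
    proof -
      \<comment> \<open>The guide \<open>x\<close> has a mark within \<open>\<rho>\<close> of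
        \<open>v\<close>, so \<open>v\<close> is treated under its colour with offset
        \<open>- m\<close>.\<close>
      obtain m where m: "m \<in> cube \<rho>" "x (v + m) \<noteq> 0" using xK(3) by blast
      have "x (v + m) \<le> ?K" using xK(1) by (simp add: PiE_iff)
      then have "(x (v + m), - m) \<in> set ps" using m by (simp add: ps)
      from fill_all_covers[OF \<rho> xK(2) a sepS SK this] show ?thesis by (simp add: H_def)
    qed
    moreover have "separated \<rho> (H ?t) \<and> H ?t \<in> configs {0..?K}"
      using fill_all_separated[OF \<rho> sepS xK(2) a SK] by (simp add: H_def)
    ultimately show ?thesis unfolding C_def marker_shift_iff[OF \<rho>] by blast
  qed
  moreover have "H (\<lambda>g. (0, x g, y g)) = x" if "x \<in> C" for x y
  proof -
    have "S (\<lambda>g. (0, x g, y g)) = x" by (simp add: S_def)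
    then show ?thesis using that fill_all_complete
      unfolding C_def marker_shift_iff[OF \<rho>] H_def by metis
  qed
  moreover have "H (\<lambda>g. (1, x g, y g)) = y" if "y \<in> C" for x y
  proof -
    have "S (\<lambda>g. (1, x g, y g)) = y"
      using 0 by (intro ext) (auto simp: S_def)
    then show ?thesis using that fill_all_complete
      unfolding C_def marker_shift_iff[OF \<rho>] H_def by metis
  qed
  ultimately show ?thesis by (intro exI[of _ H]) blast
qed

text \<open>Take the lattice of sites with all coordinates divisible by \<open>\<rho> + 1\<close>,
  coloured by the quotients modulo 4. This uses \<open>4 ^ CARD('n)\<close> colours, and equal
  colours are at least \<open>4 * (\<rho> + 1)\<close> apart.\<close>

lemma marker_shift_nonempty:
  assumes \<rho>: "0 \<le> \<rho>"
  shows "\<exists>c. c \<in> (marker_shift \<rho> (8 ^ CARD('n) + 1) :: (int ^ 'n::finite \<Rightarrow> nat) set)"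
proof -
  let ?K = "8 ^ CARD('n) + 1 :: nat" and ?F = "UNIV \<rightarrow>\<^sub>E {0..3} :: ('n \<Rightarrow> int) set"
  have finF: "finite ?F" by (intro finite_PiE) auto
  have "card ?F = 4 ^ CARD('n)" by (subst card_PiE) simp_all
  also have "\<dots> \<le> (8::nat) ^ CARD('n)" by (rule power_mono) simp_all
  finally have "card ?F \<le> card {1..?K}" by simp
  then obtain col where col: "col ` ?F \<subseteq> {1..?K}" "inj_on col ?F"
    using card_le_inj[OF finF, of "{1..?K}"] by auto
  let ?n = "\<rho> + 1"
  define res where "res = (\<lambda>(v::int ^ 'n) i. (v $ i div ?n) mod 4)"
  have res: "res v \<in> ?F" for v
  proof -
    have "res v i \<in> {0..3}" for i
      using pos_mod_bound[of 4 "v $ i div ?n"] by (simp add: res_def)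
    then show ?thesis by (simp add: PiE_iff)
  qed
  define c where "c = (\<lambda>v::int ^ 'n. if \<forall>i. ?n dvd v $ i then col (res v) else 0)"
  have colK: "1 \<le> col (res v)" "col (res v) \<le> ?K" for v
  proof -
    have "col (res v) \<in> {1..?K}" using col(1) res[of v] by blast
    then show "1 \<le> col (res v)" "col (res v) \<le> ?K" by simp_all
  qed
  have nz: "c v \<noteq> 0 \<longleftrightarrow> (\<forall>i. ?n dvd v $ i)" for v using colK(1)[of v] by (auto simp: c_def)
  have "separated \<rho> c"
    unfolding separated_def
  proof (intro allI impI)
    fix u v assume uv: "u \<noteq> v" "c u \<noteq> 0" "c v \<noteq> 0"
    then obtain i where i: "u $ i \<noteq> v $ i" by (auto simp: vec_eq_iff)
    obtain a where a: "u $ i = ?n * a" using uv(2)[unfolded nz] by (metis dvdE)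
    obtain b where b: "v $ i = ?n * b" using uv(3)[unfolded nz] by (metis dvdE)
    have ab: "a \<noteq> b" using i a b by auto
    have diff: "\<bar>(u - v) $ i\<bar> = ?n * \<bar>a - b\<bar>"
      using \<rho> by (simp add: a b right_diff_distrib[symmetric] abs_mult)
    have "?n * 1 \<le> ?n * \<bar>a - b\<bar>" using ab \<rho> by (intro mult_left_mono) auto
    then have "\<not> \<bar>(u - v) $ i\<bar> \<le> \<rho>"
      unfolding diff not_le by (rule less_le_trans[rotated]) simp
    then have "u - v \<notin> cube \<rho>" unfolding cube_def by blast
    moreover have "u - v \<notin> cube (4 * \<rho>)" if eq: "c u = c v"
    proof -
      have "col (res u) = col (res v)" using eq uv(2,3)[unfolded nz] by (simp add: c_def)
      then have "res u i = res v i" using inj_onD[OF col(2)] res by metis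
      then have "a mod 4 = b mod 4" using \<rho> by (simp add: res_def a b)
      then have "4 dvd a - b" by (simp add: mod_eq_dvd_iff)
      then have "4 \<le> \<bar>a - b\<bar>" using ab dvd_imp_le_int[of "a - b" 4] by simp
      then have "?n * 4 \<le> ?n * \<bar>a - b\<bar>" using \<rho> by (intro mult_left_mono) auto
      then have "\<not> \<bar>(u - v) $ i\<bar> \<le> 4 * \<rho>"
        unfolding diff not_le by (rule less_le_trans[rotated]) simp
      then show ?thesis unfolding cube_def by blast
    qed
    ultimately show "u - v \<notin> cube \<rho> \<and> (c u = c v \<longrightarrow> u - v \<notin> cube (4 * \<rho>))" by blast
  qed
  moreover have "c \<in> configs {0..?K}" using colK by (simp add: c_def PiE_iff)
  moreover have "\<exists>m\<in>cube \<rho>. c (v + m) \<noteq> 0" for v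
  proof -
    define m :: "int ^ 'n" where "m = (\<chi> i. - (v $ i mod ?n))"
    have "\<bar>v $ i mod ?n\<bar> \<le> \<rho>" for i
      using pos_mod_bound[of ?n "v $ i"] pos_mod_sign[of ?n "v $ i"] \<rho> by linarith
    then have "m \<in> cube \<rho>" by (simp add: m_def cube_def)
    moreover have "?n dvd (v + m) $ i" for i by (simp add: m_def minus_mod_eq_mult_div)
    then have "c (v + m) \<noteq> 0" unfolding nz by blast
    ultimately show ?thesis by blast
  qed
  ultimately show ?thesis unfolding marker_shift_iff[OF \<rho>] by blast
qed

section \<open>FEP subshifts are factors of contractible SFTs\<close>

text \<open>Patterns are encoded as maps into \<open>'a option\<close>, so that the domain becomes part of the
  local data.\<close>

locale fep_extension =
  fixes A :: "'a set" and Y :: "(int ^ 'n::finite \<Rightarrow> 'a) set"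
    and W N :: "(int ^ 'n) set" and r :: int and K :: nat
  assumes Y: "subshift A Y" and window: "is_window A Y W" and nonempty: "Y \<noteq> {}"
    and N0: "0 \<in> N" and WN: "W \<union> N \<subseteq> cube r" and r: "0 \<le> r"
    and ext: "\<And>D p. D \<noteq> {} \<Longrightarrow> locally_valid A Y W (D + N) p \<Longrightarrow>
      globally_valid Y D (restrict p D)"
begin

definition valid :: "(int ^ 'n \<Rightarrow> 'a option) \<Rightarrow> bool" where
  "valid s \<longleftrightarrow> (\<forall>v a. s v = Some a \<longrightarrow> a \<in> A) \<and>
     (\<forall>g. (\<forall>w\<in>W. s (g + w) \<noteq> None) \<longrightarrow> restrict (\<lambda>w. the (s (g + w))) W \<notin> forbidden A Y W)"

text \<open>The domain of \<open>core s\<close> is the largest \<open>D\<close> with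
  \<open>D + N\<close> inside the domain of \<open>s\<close>, hence the part to which the extension
  property applies.\<close>

definition core :: "(int ^ 'n \<Rightarrow> 'a option) \<Rightarrow> int ^ 'n \<Rightarrow> 'a option" where
  "core s v = (if \<forall>n\<in>N. s (v + n) \<noteq> None then s v else None)"

lemma core_eq: "core s v \<noteq> None \<Longrightarrow> core s v = s v"
  unfolding core_def by (metis (full_types))

text \<open>The extension property in the \<open>option\<close> encoding. An empty core is treated
  apart, as \<open>ext\<close> speaks of nonempty \<open>D\<close>; any point of \<open>Y\<close>
  serves there.\<close>

lemma valid_extends:
  assumes s: "valid s"
  shows "\<exists>x\<in>Y. \<forall>v. core s v \<noteq> None \<longrightarrow> core s v = Some (x v)"
proof -
  define D where "D = {v. core s v \<noteq> None}"
  show ?thesis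
  proof (cases "D = {}")
    case True
    then show ?thesis using nonempty by (auto simp: D_def)
  next
    case False
    have dom: "s v \<noteq> None" if v: "v \<in> D + N" for v
    proof -
      obtain d n where "d \<in> D" "n \<in> N" "v = d + n" using v by (auto simp: set_plus_def)
      then show ?thesis by (auto simp: D_def core_def split: if_splits)
    qed
    let ?p = "restrict (\<lambda>v. the (s v)) (D + N)"
    have "locally_valid A Y W (D + N) ?p"
      unfolding locally_valid_iff
    proof (intro conjI allI impI)
      have "the (s v) \<in> A" if "v \<in> D + N" for v
        using dom[OF that] s by (auto simp: valid_def)
      then show "?p \<in> D + N \<rightarrow>\<^sub>E A" by simp
      fix g assume g: "(+) g ` W \<subseteq> D + N"
      have "restrict (\<lambda>w. ?p (g + w)) W = restrict (\<lambda>w. the (s (g + w))) W"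
        using g by (intro restrict_ext) auto
      moreover have "\<forall>w\<in>W. s (g + w) \<noteq> None" using g dom by blast
      ultimately show "restrict (\<lambda>w. ?p (g + w)) W \<notin> forbidden A Y W"
        using s by (simp add: valid_def)
    qed
    from ext[OF False this] obtain x where x: "x \<in> Y" "restrict ?p D = restrict x D"
      by (auto simp: globally_valid_def)
    have "core s v = Some (x v)" if v: "core s v \<noteq> None" for v
    proof -
      have vD: "v \<in> D" using v by (simp add: D_def)
      then have "v \<in> D + N" using set_plus_intro[of v D 0 N] N0 by simp
      then have "the (s v) = x v" using fun_cong[OF x(2), of v] vD by simp
      then show ?thesis using v core_eq[OF v] by auto
    qed
    then show ?thesis using x(1) by blast
  qed
qed

section \<open>The scales and a single round of repair\<close>

definition \<rho> :: int where "\<rho> = (int K + 1) * r"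
definition \<sigma> :: int where "\<sigma> = \<rho> + int K * r"

text \<open>A ball of radius \<open>\<sigma>\<close> may lose \<open>r\<close> in each of up to
  \<open>K\<close> later rounds and still have radius \<open>\<rho>\<close>, which the covering by
  marks requires. By the last equation a ball is disjoint from the ball, enlarged by the window
  diameter \<open>2 * r\<close>, around any other site of its colour.\<close>

lemma radii: "0 \<le> \<rho>" "0 \<le> \<sigma>" "\<rho> \<le> \<sigma>" "2 * \<sigma> + 2 * r = 4 * \<rho>"
  using r by (simp_all add: \<rho>_def \<sigma>_def algebra_simps)

text \<open>The choice depends only on the pattern relative to the centre, never on the centre
  itself; this is why the resulting map is local and equivariant.\<close>

definition completion :: "(int ^ 'n \<Rightarrow> 'a option) \<Rightarrow> int ^ 'n \<Rightarrow> 'a" where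
  "completion q = (SOME x. x \<in> Y \<and> (\<forall>d. q d \<noteq> None \<longrightarrow> q d = Some (x d)))"

definition around :: "(int ^ 'n \<Rightarrow> 'a option) \<Rightarrow> int ^ 'n \<Rightarrow> int ^ 'n \<Rightarrow> 'a option" where
  "around s v = (\<lambda>d. if d \<in> cube (\<sigma> + 2 * r) then core s (v + d) else None)"

text \<open>Sites outside the balls keep only their core, because beyond it a completion need not
  agree with \<open>s\<close>.\<close>

definition glue_step ::
  "nat \<Rightarrow> (int ^ 'n \<Rightarrow> nat) \<Rightarrow> (int ^ 'n \<Rightarrow> 'a option) \<Rightarrow> int ^ 'n \<Rightarrow> 'a option" where
  "glue_step j c s u = (if \<exists>m\<in>cube \<sigma>. c (u + m) = j
     then let m = SOME m. m \<in> cube \<sigma> \<and> c (u + m) = j in Some (completion (around s (u + m)) (- m))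
     else core s u)"

lemma completion_around:
  assumes s: "valid s"
  shows "completion (around s v) \<in> Y"
    "\<And>d. d \<in> cube (\<sigma> + 2 * r) \<Longrightarrow> core s (v + d) \<noteq> None \<Longrightarrow>
      core s (v + d) = Some (completion (around s v) d)"
proof -
  obtain x where x: "x \<in> Y" "\<forall>v. core s v \<noteq> None \<longrightarrow> core s v = Some (x v)"
    using valid_extends[OF s] by blast
  define P where "P = (\<lambda>x. x \<in> Y \<and> (\<forall>d. around s v d \<noteq> None \<longrightarrow> around s v d = Some (x d)))"
  have "P (shift (- v) x)"
    using x subshift_shift[OF Y x(1)] by (simp add: P_def around_def shift_minus_apply)
  then have "P (completion (around s v))"
    unfolding completion_def P_def[symmetric] by (rule someI[of P])
  then have *: "completion (around s v) \<in> Y \<and> (\<forall>d. around s v d \<noteq> None \<longrightarrow>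
      around s v d = Some (completion (around s v) d))" unfolding P_def .
  then show "completion (around s v) \<in> Y" by blast
  fix d :: "int ^ 'n" assume "d \<in> cube (\<sigma> + 2 * r)" "core s (v + d) \<noteq> None"
  then show "core s (v + d) = Some (completion (around s v) d)"
    using conjunct2[OF *] by (auto simp: around_def split: if_splits)
qed

lemma same_colour:
  assumes "separated \<rho> c" "c u = j" "c v = j" "j \<noteq> 0" "u - v \<in> cube (4 * \<rho>)"
  shows "u = v"
  using assms unfolding separated_def by metis

text \<open>Two centres of colour \<open>j\<close> within \<open>\<sigma>\<close> of one site would
  differ by at most \<open>2 * \<sigma>\<close>, so the chosen one is \<open>v\<close>.\<close>

lemma glue_step_ball:
  assumes c: "separated \<rho> c" and v: "c v = j" "j \<noteq> 0" and m: "m \<in> cube \<sigma>"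
  shows "glue_step j c s (v + m) = Some (completion (around s v) m)"
proof -
  have *: "- m \<in> cube \<sigma> \<and> c (v + m + - m) = j" using v(1) m by simp
  define m' where "m' = (SOME m'. m' \<in> cube \<sigma> \<and> c (v + m + m') = j)"
  have m': "m' \<in> cube \<sigma>" "c (v + m + m') = j"
    using someI[of "\<lambda>m'. m' \<in> cube \<sigma> \<and> c (v + m + m') = j", OF *] by (simp_all add: m'_def)
  have "m + m' \<in> cube (4 * \<rho>)" using cube_add[OF m m'(1)] radii r by simp
  then have "v + m + m' = v" by (intro same_colour[OF c m'(2) v]) (simp add: add.assoc)
  then have "m' = - m" by (metis add.assoc add_left_cancel add.right_neutral add_eq_0_iff)
  moreover have "\<exists>m'\<in>cube \<sigma>. c (v + m + m') = j" using m' by blast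
  ultimately show ?thesis unfolding glue_step_def Let_def m'_def[symmetric] by simp
qed

text \<open>A window that meets the ball around a centre \<open>v\<close> lies in the larger ball in which the
  extension chosen at \<open>v\<close> agrees with the old pattern.\<close>

lemma valid_glue_step:
  assumes s: "valid s" and c: "separated \<rho> c" and j: "j \<noteq> 0"
  shows "valid (glue_step j c s)"
proof -
  let ?T = "glue_step j c s"
  note YA = subshift_subset_configs[OF Y]
  have core_no: "?T u = core s u" if "\<not> (\<exists>m\<in>cube \<sigma>. c (u + m) = j)" for u
    using that by (simp add: glue_step_def)
  show ?thesis
    unfolding valid_def
  proof (intro conjI allI impI)
    fix u a assume Tu: "?T u = Some a"
    show "a \<in> A"
    proof (cases "\<exists>m\<in>cube \<sigma>. c (u + m) = j")
      case True
      then obtain v d where "a = completion (around s v) d"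
        using Tu by (auto simp: glue_step_def Let_def)
      moreover have "completion (around s v) \<in> configs A" using completion_around(1)[OF s] YA by blast
      ultimately show ?thesis by (simp add: PiE_iff)
    next
      case False
      then have "s u = Some a" using Tu core_no core_eq by (metis option.distinct(1))
      then show ?thesis using s by (auto simp: valid_def)
    qed
  next
    fix g assume dom: "\<forall>w\<in>W. ?T (g + w) \<noteq> None"
    show "restrict (\<lambda>w. the (?T (g + w))) W \<notin> forbidden A Y W"
    proof (cases "\<exists>w\<in>W. \<exists>m\<in>cube \<sigma>. c (g + w + m) = j")
      case True
      then obtain w0 m0 where w0: "w0 \<in> W" and m0: "m0 \<in> cube \<sigma>" "c (g + w0 + m0) = j" by blast
      define v where "v = g + w0 + m0"
      have v: "c v = j" using m0 by (simp add: v_def)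
      let ?x = "completion (around s v)"
      have "?T (g + w) = Some (?x (g - v + w))" if w: "w \<in> W" for w
      proof -
        have "w \<in> cube r" "w0 \<in> cube r" using w w0 WN by auto
        then have "w - w0 \<in> cube (2 * r)" by (rule cube_diff) simp
        then have "(w - w0) - m0 \<in> cube (\<sigma> + 2 * r)" by (rule cube_diff[OF _ m0(1)]) simp
        moreover have gvw: "g - v + w = (w - w0) - m0" by (simp add: v_def algebra_simps)
        ultimately have d: "g - v + w \<in> cube (\<sigma> + 2 * r)" by (simp only:)
        have vo: "v + (g - v + w) = g + w" by simp
        show ?thesis
        proof (cases "\<exists>m\<in>cube \<sigma>. c (g + w + m) = j")
          case True
          then obtain m where m: "m \<in> cube \<sigma>" "c (g + w + m) = j" by blast
          \<comment> \<open>The radii \<open>\<sigma> + 2 * r\<close> and \<open>\<sigma>\<close>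
            add up to exactly \<open>4 * \<rho>\<close>: any centre of colour \<open>j\<close>
            reached from this window must be \<open>v\<close>.\<close>
          have "(g - v + w) + m \<in> cube (4 * \<rho>)" using cube_add[OF d m(1)] radii by simp
          then have "g + w + m - v \<in> cube (4 * \<rho>)" by (simp add: algebra_simps)
          then have "g + w + m = v" by (rule same_colour[OF c m(2) v j])
          then have "g - v + w = - m" by (simp add: algebra_simps flip: add_eq_0_iff)
          then have "g - v + w \<in> cube \<sigma>" using m(1) by simp
          from glue_step_ball[OF c v j this, of s] show ?thesis unfolding vo .
        next
          case False
          then have "?T (g + w) = core s (v + (g - v + w))" using core_no vo by simp
          moreover from this have "core s (v + (g - v + w)) \<noteq> None" using dom w by metis
          ultimately show ?thesis using completion_around(2)[OF s d] by metis
        qed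
      qed
      then have "restrict (\<lambda>w. the (?T (g + w))) W = restrict (\<lambda>w. ?x (g - v + w)) W"
        by (intro restrict_ext) simp
      then show ?thesis using not_forbidden[OF completion_around(1)[OF s]] by metis
    next
      case False
      have T: "?T (g + w) = core s (g + w)" if "w \<in> W" for w
        using False that core_no by blast
      then have *: "core s (g + w) \<noteq> None" if "w \<in> W" for w using dom that by metis
      then have Ts: "?T (g + w) = s (g + w)" if "w \<in> W" for w using T core_eq that by metis
      then have "restrict (\<lambda>w. the (?T (g + w))) W = restrict (\<lambda>w. the (s (g + w))) W"
        by (intro restrict_ext) simp
      moreover have "\<forall>w\<in>W. s (g + w) \<noteq> None" using Ts dom by metis
      ultimately show ?thesis using s by (simp add: valid_def)
    qed
  qed
qed

primrec glue ::
  "nat \<Rightarrow> (int ^ 'n \<Rightarrow> nat) \<Rightarrow> (int ^ 'n \<Rightarrow> 'a option) \<Rightarrow> int ^ 'n \<Rightarrow> 'a option" where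
  "glue 0 c s = s"
| "glue (Suc n) c s = glue_step (Suc n) c (glue n c s)"

lemma valid_glue: "valid s \<Longrightarrow> separated \<rho> c \<Longrightarrow> valid (glue n c s)"
  by (induction n) (simp_all add: valid_glue_step)

text \<open>Each later step erodes the domain by at most \<open>r\<close>.\<close>

lemma glue_covers:
  assumes c: "separated \<rho> c" and v: "c v = j" "j \<noteq> 0" "j \<le> n"
    and m: "m \<in> cube (\<sigma> - (int n - int j) * r)"
  shows "glue n c s (v + m) \<noteq> None"
  using v(3) m
proof (induction n arbitrary: m)
  case 0 then show ?case using v(2) by simp
next
  case (Suc n)
  show ?case
  proof (cases "j = Suc n")
    case True
    then show ?thesis using glue_step_ball[OF c v(1,2), of m] Suc.prems by simp
  next
    case False
    then have jn: "j \<le> n" using Suc.prems(1) by simp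
    have *: "glue n c s (v + m + n') \<noteq> None" if "n' \<in> N" for n'
    proof -
      have "n' \<in> cube r" using that WN by blast
      then have "m + n' \<in> cube (\<sigma> - (int n - int j) * r)"
        by (rule cube_add[OF Suc.prems(2)]) (simp add: algebra_simps)
      from Suc.IH[OF jn this] show ?thesis by (simp add: add.assoc)
    qed
    then have "core (glue n c s) (v + m) \<noteq> None" using *[OF N0] by (simp add: core_def)
    then show ?thesis by (auto simp: glue_step_def Let_def)
  qed
qed

text \<open>The window at \<open>v - w\<close> shows \<open>v\<close> in position \<open>w\<close>;
  a site is deleted as soon as one window through it is bad.\<close>

definition seed :: "(int ^ 'n \<Rightarrow> 'a) \<Rightarrow> int ^ 'n \<Rightarrow> 'a option" where
  "seed p v = (if \<forall>w\<in>W. restrict (\<lambda>w'. p (v + (- w + w'))) W \<notin> forbidden A Y W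
     then Some (p v) else None)"

definition repair :: "(int ^ 'n \<Rightarrow> nat) \<Rightarrow> (int ^ 'n \<Rightarrow> 'a) \<Rightarrow> int ^ 'n \<Rightarrow> 'a" where
  "repair c p = (\<lambda>v. the (glue K c (seed p) v))"

text \<open>A window without deleted sites is vouched for by any one of its sites. The empty window
  has no site and is settled by a point of \<open>Y\<close>.\<close>

lemma valid_seed:
  assumes p: "p \<in> configs A"
  shows "valid (seed p)"
  unfolding valid_def
proof (intro conjI allI impI)
  fix v a assume "seed p v = Some a"
  then show "a \<in> A" using p by (auto simp: seed_def PiE_iff split: if_splits)
next
  fix g assume dom: "\<forall>w\<in>W. seed p (g + w) \<noteq> None"
  show "restrict (\<lambda>w. the (seed p (g + w))) W \<notin> forbidden A Y W"
  proof (cases "W = {}")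
    case True
    obtain y where "y \<in> Y" using nonempty by blast
    from not_forbidden[OF this, of g W A] show ?thesis using True by (simp add: restrict_def)
  next
    case False
    then obtain w0 where w0: "w0 \<in> W" by blast
    have "seed p (g + w0) \<noteq> None" using dom w0 by blast
    then have "restrict (\<lambda>w'. p (g + w0 + (- w0 + w'))) W \<notin> forbidden A Y W"
      using w0 by (auto simp: seed_def split: if_splits)
    moreover have "g + w0 + (- w0 + w') = g + w'" for w' by simp
    moreover have "the (seed p (g + w)) = p (g + w)" if "w \<in> W" for w
      using dom that by (auto simp: seed_def split: if_splits)
    then have "restrict (\<lambda>w. the (seed p (g + w))) W = restrict (\<lambda>w. p (g + w)) W"
      by (intro restrict_ext)
    ultimately show ?thesis by simp
  qed
qed

lemma repair_in:
  assumes c: "c \<in> marker_shift \<rho> K" and p: "p \<in> configs A"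
  shows "repair c p \<in> Y"
proof -
  have cK: "c \<in> configs {0..K}" "separated \<rho> c" "\<And>v. \<exists>m\<in>cube \<rho>. c (v + m) \<noteq> 0"
    using c unfolding marker_shift_iff[OF radii(1)] by blast+
  let ?s = "glue K c (seed p)"
  have valid: "valid ?s" by (rule valid_glue[OF valid_seed[OF p] cK(2)])
  have total: "?s u \<noteq> None" for u
  proof -
    obtain m where m: "m \<in> cube \<rho>" "c (u + m) \<noteq> 0" using cK(3) by blast
    have "c (u + m) \<in> {0..K}" using cK(1) by (simp add: PiE_iff)
    then have le: "c (u + m) \<le> K" by simp
    \<comment> \<open>By definition of \<open>\<sigma>\<close> the right-hand side is
      \<open>\<rho>\<close> plus the colour times \<open>r\<close>.\<close>
    have "\<rho> \<le> \<sigma> - (int K - int (c (u + m))) * r"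
      unfolding \<sigma>_def left_diff_distrib using r by simp
    with uminus_in_cube_iff[THEN iffD2, OF m(1)]
    have "- m \<in> cube (\<sigma> - (int K - int (c (u + m))) * r)" by (rule cube_mono)
    from glue_covers[OF cK(2) refl m(2) le this, of "seed p"] show ?thesis
      by (simp only: add.assoc add.right_inverse add.right_neutral not_False_eq_True)
  qed
  have "the (?s u) \<in> A" for u using valid total[of u] by (auto simp: valid_def)
  then have "repair c p \<in> configs A" by (simp add: repair_def PiE_iff)
  moreover have "restrict (\<lambda>w. repair c p (g + w)) W \<notin> forbidden A Y W" for g
    using valid total by (simp add: valid_def repair_def)
  ultimately show ?thesis by (rule window_config[OF window])
qed

text \<open>On a point of \<open>Y\<close> nothing is deleted and the core is everything, so every
  completion must reproduce the point inside its ball. This makes the repair map onto.\<close>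

lemma repair_id:
  assumes c: "separated \<rho> c" and p: "p \<in> Y"
  shows "repair c p = p"
proof -
  have pA: "p \<in> configs A" using p subshift_subset_configs[OF Y] by blast
  have seed: "seed p = (\<lambda>v. Some (p v))"
  proof
    fix v
    have "restrict (\<lambda>w'. p (v + (- w + w'))) W \<notin> forbidden A Y W" for w
      using not_forbidden[OF p, of "v + - w" W A] unfolding add.assoc .
    then show "seed p v = Some (p v)" by (simp add: seed_def)
  qed
  have val: "valid (\<lambda>v. Some (p v))" using valid_seed[OF pA] by (simp add: seed)
  have co: "core (\<lambda>v. Some (p v)) v = Some (p v)" for v by (simp add: core_def)
  have "glue n c (seed p) = (\<lambda>v. Some (p v))" for n
  proof (induction n)
    case 0 then show ?case by (simp add: seed)
  next
    case (Suc n)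
    have "glue_step (Suc n) c (\<lambda>v. Some (p v)) u = Some (p u)" for u
    proof (cases "\<exists>m\<in>cube \<sigma>. c (u + m) = Suc n")
      case True
      then obtain m where m: "m \<in> cube \<sigma>" "c (u + m) = Suc n" by blast
      have m': "- m \<in> cube \<sigma>" using m(1) by simp
      have "- m \<in> cube (\<sigma> + 2 * r)" using cube_mono[OF m'] r by simp
      from completion_around(2)[OF val this, of "u + m"]
      have "completion (around (\<lambda>v. Some (p v)) (u + m)) (- m) = p u" by (simp add: co)
      moreover have "glue_step (Suc n) c (\<lambda>v. Some (p v)) (u + m + - m) =
          Some (completion (around (\<lambda>v. Some (p v)) (u + m)) (- m))"
        by (rule glue_step_ball[OF c m(2) _ m']) simp
      ultimately show ?thesis by simp
    next
      case False
      then show ?thesis by (simp add: glue_step_def co)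
    qed
    then show ?case by (simp add: Suc.IH fun_eq_iff)
  qed
  then show ?thesis by (simp add: repair_def)
qed

section \<open>Locality of the repair map\<close>

lemma finite_WN: "finite W" "finite N"
  using finite_subset[OF WN finite_cube] by simp_all

lemma local_map_seed: "local_map seed"
proof (rule local_mapI)
  show "finite (insert 0 ((\<lambda>(w, w'). - w + w') ` (W \<times> W)))" using finite_WN(1) by simp
  fix p p' :: "int ^ 'n \<Rightarrow> 'a" and g g'
  assume eq: "\<And>m. m \<in> insert 0 ((\<lambda>(w, w'). - w + w') ` (W \<times> W)) \<Longrightarrow> p (g + m) = p' (g' + m)"
  have "p g = p' g'" using eq[of 0] by simp
  moreover have "restrict (\<lambda>w'. p (g + (- w + w'))) W = restrict (\<lambda>w'. p' (g' + (- w + w'))) W"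
    if "w \<in> W" for w
    by (intro restrict_ext eq) (use that in force)
  ultimately show "seed p g = seed p' g'" by (simp add: seed_def cong: ball_cong)
qed

lemma local_map_glue_step:
  fixes C :: "(int ^ 'n \<Rightarrow> 'b) \<Rightarrow> int ^ 'n \<Rightarrow> nat"
  assumes C: "local_map C" and S: "local_map S"
  shows "local_map (\<lambda>t. glue_step j (C t) (S t))"
proof -
  have "local_map (\<lambda>q. glue_step j (\<lambda>v. fst (q v)) (\<lambda>v. snd (q v)))"
  proof (rule local_mapI)
    \<comment> \<open>From a site to its centre, from there over the surroundings of the completion,
      and from each of these by \<open>N\<close> to determine the core.\<close>
    let ?M = "cube \<sigma> + (cube (\<sigma> + 2 * r) + N)"
    show "finite ?M" by (intro finite_set_plus finite_cube finite_WN)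
    fix q q' :: "int ^ 'n \<Rightarrow> nat \<times> 'a option" and g g'
    assume eq: "\<And>m. m \<in> ?M \<Longrightarrow> q (g + m) = q' (g' + m)"
    have "0 \<in> cube \<sigma>" "0 \<in> cube (\<sigma> + 2 * r)" using radii r by simp_all
    note zero = this
    have 3: "q (g + m + d + n) = q' (g' + m + d + n)"
      if "m \<in> cube \<sigma>" "d \<in> cube (\<sigma> + 2 * r)" "n \<in> N" for m d n
      using eq[of "m + (d + n)"] that by (simp add: set_plus_intro add.assoc)
    have 2: "q (g + m + d) = q' (g' + m + d)" if "m \<in> cube \<sigma>" "d \<in> cube (\<sigma> + 2 * r)" for m d
      using 3[OF that N0] by simp
    have 1: "q (g + m) = q' (g' + m)" if "m \<in> cube \<sigma>" for m
      using 2[OF that zero(2)] by simp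
    have "core (\<lambda>v. snd (q v)) (g + m + d) = core (\<lambda>v. snd (q' v)) (g' + m + d)"
      if "m \<in> cube \<sigma>" "d \<in> cube (\<sigma> + 2 * r)" for m d
    proof -
      have "(\<forall>n\<in>N. snd (q (g + m + d + n)) \<noteq> None) = (\<forall>n\<in>N. snd (q' (g' + m + d + n)) \<noteq> None)"
        by (intro ball_cong refl) (simp add: 3[OF that])
      then show ?thesis unfolding core_def 2[OF that] by (simp only:)
    qed
    note core = this
    have ar: "around (\<lambda>v. snd (q v)) (g + m) = around (\<lambda>v. snd (q' v)) (g' + m)"
      if "m \<in> cube \<sigma>" for m
      unfolding around_def using core[OF that] by (simp add: fun_eq_iff)
    have ex: "(\<exists>m\<in>cube \<sigma>. fst (q (g + m)) = j) \<longleftrightarrow> (\<exists>m\<in>cube \<sigma>. fst (q' (g' + m)) = j)"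
      by (intro bex_cong refl) (simp add: 1)
    have "(m \<in> cube \<sigma> \<and> fst (q (g + m)) = j) \<longleftrightarrow> (m \<in> cube \<sigma> \<and> fst (q' (g' + m)) = j)" for m
      using 1[of m] by auto
    \<comment> \<open>Equal predicates have equal choices: the arbitrary \<open>SOME\<close> picks
      the same relative centre at both sites.\<close>
    then have some: "(SOME m. m \<in> cube \<sigma> \<and> fst (q (g + m)) = j) =
        (SOME m. m \<in> cube \<sigma> \<and> fst (q' (g' + m)) = j)" by simp
    show "glue_step j (\<lambda>v. fst (q v)) (\<lambda>v. snd (q v)) g
        = glue_step j (\<lambda>v. fst (q' v)) (\<lambda>v. snd (q' v)) g'"
    proof (cases "\<exists>m\<in>cube \<sigma>. fst (q' (g' + m)) = j")
      case True
      define m where "m = (SOME m. m \<in> cube \<sigma> \<and> fst (q' (g' + m)) = j)"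
      have "m \<in> cube \<sigma> \<and> fst (q' (g' + m)) = j"
        unfolding m_def by (rule someI_ex) (use True in blast)
      then show ?thesis using True ar[of m]
        unfolding glue_step_def ex some m_def[symmetric] Let_def by simp
    next
      case False
      then show ?thesis using core[OF zero] unfolding glue_step_def ex by simp
    qed
  qed
  from local_map_compose[OF this local_map_pair[OF C S]] show ?thesis by simp
qed

lemma local_map_glue:
  fixes C :: "(int ^ 'n \<Rightarrow> 'b) \<Rightarrow> int ^ 'n \<Rightarrow> nat"
  assumes "local_map C" "local_map S"
  shows "local_map (\<lambda>t. glue n (C t) (S t))"
  using assms(2) by (induction n) (simp_all add: local_map_glue_step[OF assms(1)])

lemma local_map_repair: "local_map (\<lambda>t. repair (\<lambda>v. fst (t v)) (\<lambda>v. snd (t v)))"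
proof -
  have "local_map (\<lambda>t. glue K (\<lambda>v. fst (t v)) (seed (\<lambda>v. snd (t v))))"
    by (intro local_map_glue local_map_pointwise local_map_compose[OF local_map_seed])
  from local_map_compose[OF local_map_pointwise[of the] this] show ?thesis
    by (simp add: repair_def)
qed

end

lemma finite_inj_on_infinite_type:
  assumes "finite B"
  shows "\<exists>f :: 'b \<Rightarrow> 'a::infinite. inj_on f B"
proof -
  obtain A :: "'a set" where "finite A" "card A = card B"
    using infinite_arbitrarily_large[OF infinite_UNIV] by blast
  then show ?thesis using card_le_inj[OF assms, of A] by auto
qed

text \<open>The covering system is the product of a marker shift with the full shift over \<open>A\<close>, with
  its alphabet renamed into \<open>'a\<close>.\<close>

lemma fep_imp_factor:
  fixes A :: "'a::infinite set" and Y :: "(int ^ 'n::finite \<Rightarrow> 'a) set"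
  assumes fep: "fep A Y"
  shows "(A, Y) \<in> SFT_factors_of_contractible_SFTs"
proof (cases "Y = {}")
  \<comment> \<open>The empty subshift is its own contractible cover; in the other case completions
    can draw on a point of \<open>Y\<close>.\<close>
  case True
  have sft: "sft A Y" using fep by (simp add: fep_def)
  have "contractible_shift A Y"
    by (rule contractible_shift_local_map[OF _ local_map_pointwise[of "\<lambda>p. fst (snd p)"]])
      (simp_all add: True)
  then have "(A, Y) \<in> contractible_SFTs" using sft by (simp add: contractible_SFTs_def)
  moreover have "block_map A Y A Y (\<lambda>x. x)"
    by (rule block_map_local_map[OF local_map_pointwise[of "\<lambda>a. a"]]) (simp_all add: True)
  ultimately show ?thesis using sft True unfolding SFT_factors_of_contractible_SFTs_def by blast
next
  case False
  have sft: "sft A Y" using fep by (simp add: fep_def)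
  then have sub: "subshift A Y" and finA: "finite A" by (simp_all add: sft_def subshift_def)
  obtain W N where win: "is_window A Y W" and N: "finite N" "0 \<in> N"
    and ext: "\<And>D p. D \<noteq> {} \<Longrightarrow> locally_valid A Y W (D + N) p \<Longrightarrow>
      globally_valid Y D (restrict p D)"
    by (rule fepE[OF fep]) (rule that)
  have "finite (W \<union> N)" using win N(1) by (simp add: is_window_def)
  from finite_coordinate_bound[OF this] obtain r where r: "0 \<le> r"
      "\<And>m i. m \<in> W \<union> N \<Longrightarrow> \<bar>m $ i\<bar> \<le> r" by blast
  \<comment> \<open>The dimension alone fixes the number of colours, after which \<open>r\<close>
    determines the scale \<open>\<rho>\<close>.\<close>
  define K :: nat where "K = 8 ^ CARD('n) + 1"
  interpret fep_extension A Y W N r K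
  proof
    show "W \<union> N \<subseteq> cube r" using r(2) unfolding cube_def by blast
  qed (fact sub win False N(2) r(1) ext)+
  let ?C = "marker_shift \<rho> K :: (int ^ 'n \<Rightarrow> nat) set"
  have "finite ({0..K} \<times> A)" using finA by simp
  then obtain enc :: "nat \<times> 'a \<Rightarrow> 'a" where enc: "inj_on enc ({0..K} \<times> A)"
    using finite_inj_on_infinite_type by blast
  define dec where "dec = inv_into ({0..K} \<times> A) enc"
  have dec_enc: "dec (enc b) = b" if "b \<in> {0..K} \<times> A" for b
    unfolding dec_def using enc that by (rule inv_into_f_f)
  have enc_dec: "enc (dec b) = b" "dec b \<in> {0..K} \<times> A" if "b \<in> enc ` ({0..K} \<times> A)" for b
    using dec_enc that by auto
  let ?B = "enc ` ({0..K} \<times> A)"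
  define X :: "(int ^ 'n \<Rightarrow> 'a) set" where "X = {z \<in> configs ?B. \<forall>g. marker_at \<rho> (\<lambda>h. fst (dec (z (g + h))))}"
  have finB: "finite ?B" using finA by simp
  have loc: "marker_at \<rho> (\<lambda>h. fst (dec (y h)))"
    if "\<forall>w\<in>cube (4 * \<rho>). x w = y w" "marker_at \<rho> (\<lambda>h. fst (dec (x h)))"
    for x y :: "int ^ 'n \<Rightarrow> 'a"
    using that marker_at_cong[OF radii(1), of "\<lambda>h. fst (dec (x h))" "\<lambda>h. fst (dec (y h))"]
    by simp
  have sftX: "sft ?B X"
    by (rule sft_localI(2)[OF finB finite_cube loc X_def])
  have XB: "X \<subseteq> configs ?B" by (auto simp: X_def)
  have XD: "(\<lambda>v. fst (dec (z v))) \<in> ?C" "(\<lambda>v. snd (dec (z v))) \<in> configs A"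
    "\<And>v. enc (dec (z v)) = z v" if z: "z \<in> X" for z
  proof -
    have zB: "z v \<in> ?B" for v using z XB by (auto simp: PiE_iff)
    have "dec (z v) \<in> {0..K} \<times> A" for v using enc_dec(2)[OF zB] .
    then have "fst (dec (z v)) \<in> {0..K}" "snd (dec (z v)) \<in> A" for v by (auto simp: mem_Times_iff)
    then show "(\<lambda>v. fst (dec (z v))) \<in> ?C" "(\<lambda>v. snd (dec (z v))) \<in> configs A"
      using z by (simp_all add: X_def marker_shift_def PiE_iff)
    show "enc (dec (z v)) = z v" for v using enc_dec(1)[OF zB] .
  qed
  have XI: "(\<lambda>v. enc (c v, p v)) \<in> X" "\<And>v. dec (enc (c v, p v)) = (c v, p v)"
    if c: "c \<in> ?C" and p: "p \<in> configs A" for c p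
  proof -
    have b: "(c v, p v) \<in> {0..K} \<times> A" for v using c p by (simp add: marker_shift_def PiE_iff)
    show de: "dec (enc (c v, p v)) = (c v, p v)" for v by (rule dec_enc[OF b])
    show "(\<lambda>v. enc (c v, p v)) \<in> X"
      using b c unfolding X_def by (auto simp: de marker_shift_def PiE_iff)
  qed
  have CK: "?C = marker_shift \<rho> (8 ^ CARD('n) + 1)" by (simp only: K_def)
  have "\<exists>H. local_map H \<and>
    (\<forall>x\<in>?C. \<forall>y\<in>?C. (\<forall>i\<in>configs {0, 1}. H (\<lambda>g. (i g, x g, y g)) \<in> ?C) \<and>
      H (\<lambda>g. (0 :: nat, x g, y g)) = x \<and> H (\<lambda>g. (1, x g, y g)) = y)"
    unfolding CK by (rule marker_shift_contraction[OF radii(1)])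
  then obtain H where H0: "local_map H \<and>
    (\<forall>x\<in>?C. \<forall>y\<in>?C. (\<forall>i\<in>configs {0, 1}. H (\<lambda>g. (i g, x g, y g)) \<in> ?C) \<and>
      H (\<lambda>g. (0 :: nat, x g, y g)) = x \<and> H (\<lambda>g. (1, x g, y g)) = y)" ..
  then have H: "local_map H"
    and Hends: "\<And>x y. x \<in> ?C \<Longrightarrow> y \<in> ?C \<Longrightarrow> H (\<lambda>g. (0 :: nat, x g, y g)) = x"
      "\<And>x y. x \<in> ?C \<Longrightarrow> y \<in> ?C \<Longrightarrow> H (\<lambda>g. (1, x g, y g)) = y"
    and Hmaps: "\<And>i x y. x \<in> ?C \<Longrightarrow> y \<in> ?C \<Longrightarrow> i \<in> configs {0, 1} \<Longrightarrow> H (\<lambda>g. (i g, x g, y g)) \<in> ?C"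
    by simp_all
  \<comment> \<open>Markers are contracted by \<open>H\<close>, while the full-shift coordinate
    switches site by site between the two configurations according to \<open>i\<close>.\<close>
  define G where "G = (\<lambda>(t :: int ^ 'n \<Rightarrow> nat \<times> 'a \<times> 'a) v.
    enc (H (\<lambda>g. (fst (t g), fst (dec (fst (snd (t g)))), fst (dec (snd (snd (t g)))))) v,
      if fst (t v) = 0 then snd (dec (fst (snd (t v)))) else snd (dec (snd (snd (t v))))))"
  have locG: "local_map G"
    unfolding G_def
    by (intro local_map_compose[OF local_map_pointwise[of enc] local_map_pair]
        local_map_compose[OF H] local_map_pointwise)
  have "contractible_shift ?B X"
  proof (rule contractible_shift_local_map[OF XB locG])
    fix x y assume x: "x \<in> X" and y: "y \<in> X"
    show "G (\<lambda>g. (0, x g, y g)) = x"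
      using Hends(1)[OF XD(1)[OF x] XD(1)[OF y]] XD(3)[OF x] by (simp add: G_def)
    show "G (\<lambda>g. (1, x g, y g)) = y"
      using Hends(2)[OF XD(1)[OF x] XD(1)[OF y]] XD(3)[OF y] by (simp add: G_def)
    fix i :: "int ^ 'n \<Rightarrow> nat" assume i: "i \<in> configs {0, 1}"
    have "(\<lambda>v. if i v = 0 then snd (dec (x v)) else snd (dec (y v))) \<in> configs A"
      using XD(2)[OF x] XD(2)[OF y] by (simp add: PiE_iff)
    from XI(1)[OF Hmaps[OF XD(1)[OF x] XD(1)[OF y] i] this]
    show "G (\<lambda>g. (i g, x g, y g)) \<in> X" unfolding G_def fst_conv snd_conv .
  qed
  then have X: "(?B, X) \<in> contractible_SFTs" using sftX by (simp add: contractible_SFTs_def)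
  define f where "f = (\<lambda>z :: int ^ 'n \<Rightarrow> 'a. repair (\<lambda>v. fst (dec (z v))) (\<lambda>v. snd (dec (z v))))"
  have locf: "local_map f"
    using local_map_compose[OF local_map_repair local_map_pointwise[of dec]] by (simp add: f_def)
  have fX: "f z \<in> Y" if "z \<in> X" for z
    unfolding f_def by (rule repair_in[OF XD(1,2)[OF that]])
  have "Y \<subseteq> f ` X"
  proof
    fix y assume y: "y \<in> Y"
    then have yA: "y \<in> configs A" using subshift_subset_configs[OF sub] by blast
    \<comment> \<open>Any marker configuration can accompany \<open>y\<close>, since repair fixes
      the points of \<open>Y\<close> under every guide.\<close>
    obtain c where c: "c \<in> ?C"
      using marker_shift_nonempty[OF radii(1)] unfolding CK by blast
    have "separated \<rho> c" using c unfolding marker_shift_iff[OF radii(1)] by blast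
    then have "f (\<lambda>v. enc (c v, y v)) = y"
      using repair_id[OF _ y] by (simp add: f_def XI(2)[OF c yA])
    then show "y \<in> f ` X" using XI(1)[OF c yA] by (metis imageI)
  qed
  then have im: "f ` X = Y" using fX by blast
  have "block_map ?B X A Y f"
    by (rule block_map_local_map[OF locf XB subshift_subset_configs[OF sub] fX])
  then show ?thesis using X im sft unfolding SFT_factors_of_contractible_SFTs_def by blast
qed

theorem theorem8p9:
  fixes S :: "(int ^ 'n) set"
  assumes "CARD('n) \<ge> 2"
    and "finite S" and "symmetric_generating_set S"
  shows "(contractible_SFTs :: (int ^ 'n, 'a::infinite) shift_space set) \<subset> FEP_subshifts \<and>
         (FEP_subshifts :: (int ^ 'n, 'a) shift_space set) \<subset> SFT_factors_of_contractible_SFTs \<and>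
         (SFT_factors_of_contractible_SFTs :: (int ^ 'n, 'a) shift_space set)
           \<subseteq> strongly_irreducible_SFTs S"
proof (intro conjI)
  show "(contractible_SFTs :: (int ^ 'n, 'a) shift_space set) \<subset> FEP_subshifts"
    by (rule contractible_SFTs_psubset_FEP[OF assms(1)])
  show "(FEP_subshifts :: (int ^ 'n, 'a) shift_space set) \<subset> SFT_factors_of_contractible_SFTs"
  proof
    show "(FEP_subshifts :: (int ^ 'n, 'a) shift_space set) \<subseteq> SFT_factors_of_contractible_SFTs"
      by (auto simp: FEP_subshifts_def fep_imp_factor)
    obtain k l :: 'n where kl: "k \<noteq> l"
      using two_directions[OF assms(1)] .
    obtain enc :: "bool \<times> bool \<Rightarrow> 'a" where "inj enc"
      using finite_inj_on_infinite_type[of "UNIV :: (bool \<times> bool) set"] by auto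
    then have dec: "inv enc (enc b) = b" for b by simp
    have "(range enc, flat_shift k l (range enc) (inv enc)) \<notin> FEP_subshifts"
      using flat_shift_not_fep[where dec="inv enc", OF kl dec] by (simp add: FEP_subshifts_def)
    then show "(FEP_subshifts :: (int ^ 'n, 'a) shift_space set) \<noteq> SFT_factors_of_contractible_SFTs"
      using flat_shift_factor[where dec="inv enc", OF kl dec] by blast
  qed
  show "(SFT_factors_of_contractible_SFTs :: (int ^ 'n, 'a) shift_space set)
      \<subseteq> strongly_irreducible_SFTs S"
    unfolding SFT_factors_of_contractible_SFTs_def contractible_SFTs_def strongly_irreducible_SFTs_def
    by (auto simp: sft_def[of _ "_ :: (int ^ 'n \<Rightarrow> 'a) set"] intro: factor_strongly_irreducible)
qed

end
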